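(* Every generalized Killing spinor $\Psi$ on the standard round sphere $\mathbb{S}^8$ is a Killing spinor.
   Context: $\mathbb{S}^8$ carries the round metric $g$ of constant sectional curvature $1$ and its spin structure. $\Sigma M$ denotes the real spinor bundle of a Riemannian spin manifold $(M^n,g)$ (associated to the real spin representation, an irreducible real module over the real Clifford algebra $\mathrm{Cl}_n$; for $n=8$ it has rank $16$), with the connection $\nabla$ induced by the Levi-Civita connection and a $\nabla$-parallel Euclidean scalar product. Clifford multiplication satisfies $X\cdot Y\cdot+Y\cdot X\cdot=-2g(X,Y)\mathrm{id}$ and is skew-symmetric. A generalized Killing spinor is a non-zero spinor field $\Psi\in\Gamma(\Sigma M)$ satisfying $\nabla_X\Psi=A(X)\cdot\Psi$ for all tangent vectors $X$, where $A$ is some symmetric endomorphism field of $TM$. It is called a Killing spinor if $A=\lambda\,\mathrm{id}$ for a non-zero real constant $\lambda$. *)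

theory Defs
  imports "HOL-Analysis.Analysis"
begin

section \<open>Real Clifford algebras, spin groups and spin modules\<close>

text \<open>
  The algebra of a Euclidean space with orthonormal basis indexed by 'n, with the relation
  v * v = - |v|^2.  It has the basis e_S, S a subset of 'n, where e_S is the product of the
  e_i, i in S, in increasing order.  Reordering e_S * e_T costs one sign for each pair
  (i, j) in S * T with j < i, and one sign for each common index, because e_i * e_i = -1.
\<close>

type_synonym 'n clifford = "real ^ ('n set)"

definition cl_sign :: "'n::{finite,linorder} set \<Rightarrow> 'n set \<Rightarrow> real" where
  "cl_sign S T = (- 1) ^ card {(i, j). i \<in> S \<and> j \<in> T \<and> j \<le> i}"

definition cl_mult :: "'n::{finite,linorder} clifford \<Rightarrow> 'n clifford \<Rightarrow> 'n clifford"
    (infixl "\<odot>" 70) where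
  "x \<odot> y = (\<Sum>S\<in>UNIV. \<Sum>T\<in>UNIV. axis (sym_diff S T) (cl_sign S T * x $ S * y $ T))"

definition cl_one :: "'n::{finite,linorder} clifford" where
  "cl_one = axis {} 1"

definition cl_vec :: "real ^ 'n::{finite,linorder} \<Rightarrow> 'n clifford" where
  "cl_vec v = (\<Sum>i\<in>UNIV. axis {i} (v $ i))"

text \<open>The algebra is associative and unital and satisfies the Clifford relations.\<close>

lemma cl_sign_eq_prod: "cl_sign S T = (\<Prod>i\<in>S. \<Prod>j\<in>T. if j \<le> i then -1 else 1)"
proof -
  have "(\<Prod>i\<in>S. \<Prod>j\<in>T. if j \<le> i then -1 else (1::real)) = (\<Prod>(i,j)\<in>S\<times>T. if j \<le> i then -1 else 1)"
    by (simp add: prod.cartesian_product)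
  also have "\<dots> = (\<Prod>x\<in>{(i, j). i \<in> S \<and> j \<in> T \<and> j \<le> i}. -1)"
    by (rule prod.mono_neutral_cong_right) (auto split: if_splits)
  finally show ?thesis by (simp add: cl_sign_def)
qed

lemma prod_sym_diff_involutive: fixes f :: "'n::finite \<Rightarrow> real"
  assumes "\<And>i. f i * f i = 1"
  shows "prod f (sym_diff S T) = prod f S * prod f T"
proof -
  have S: "prod f S = prod f (S - T) * prod f (S \<inter> T)"
    by (metis finite prod.Int_Diff mult.commute)
  have T: "prod f T = prod f (T - S) * prod f (S \<inter> T)"
    by (metis finite prod.Int_Diff mult.commute Int_commute)
  have "prod f (S \<inter> T) * prod f (S \<inter> T) = 1" by (simp add: prod.distrib[symmetric] assms)
  moreover have "prod f (sym_diff S T) = prod f (S - T) * prod f (T - S)"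
    by (rule prod.union_disjoint) auto
  ultimately show ?thesis unfolding S T by (simp add: algebra_simps)
qed

lemma cl_sign_sym_diff_left: "cl_sign (sym_diff S T) R = cl_sign S R * cl_sign T R"
  unfolding cl_sign_eq_prod by (rule prod_sym_diff_involutive) (auto simp: prod.distrib[symmetric] intro!: prod.neutral)

lemma cl_sign_sym_diff_right: "cl_sign R (sym_diff S T) = cl_sign R S * cl_sign R T"
  unfolding cl_sign_eq_prod prod.distrib[symmetric] by (intro prod.cong refl prod_sym_diff_involutive) auto

lemma bilinear_cl_mult: "bilinear (\<odot>)" 
  unfolding bilinear_def
  by (auto intro!: linearI simp: cl_mult_def vec_eq_iff axis_def algebra_simps sum.distrib sum_distrib_left if_distrib[of "\<lambda>x. _ * x"] intro!: sum.cong simp flip: sum.distrib)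

lemma cl_mult_axis: "axis S a \<odot> axis T b = axis (sym_diff S T) (cl_sign S T * a * b)"
proof -
  have "axis S a \<odot> axis T b = (\<Sum>S'\<in>UNIV. \<Sum>T'\<in>UNIV. if T' = T then if S' = S then axis (sym_diff S T) (cl_sign S T * a * b) else 0 else 0)"
    unfolding cl_mult_def by (intro sum.cong refl) (auto simp: axis_def vec_eq_iff)
  then show ?thesis by simp
qed

lemma cl_mult_assoc_axis: "(axis S a \<odot> axis T b) \<odot> axis R c = axis S a \<odot> (axis T b \<odot> axis R c)"
proof -
  have "sym_diff (sym_diff S T) R = sym_diff S (sym_diff T R)" by auto
  then show ?thesis by (simp add: cl_mult_axis cl_sign_sym_diff_left cl_sign_sym_diff_right mult_ac del: Un_iff)
qed

lemma vec_eq_sum_axis: "(x::real^'n::finite) = (\<Sum>i\<in>UNIV. axis i (x$i))"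
  by (auto simp: vec_eq_iff axis_def)

lemma cl_mult_assoc: "(x \<odot> y) \<odot> z = x \<odot> (y \<odot> z)"
proof -
  have l: "linear (\<lambda>x. x \<odot> y)" "linear (\<lambda>y. x \<odot> y)" for x y :: "'n::{finite,linorder} clifford"
    using bilinear_cl_mult unfolding bilinear_def by auto
  show ?thesis
    apply (subst (1 2) vec_eq_sum_axis[of x], subst (1 2) vec_eq_sum_axis[of y], subst (1 2) vec_eq_sum_axis[of z])
    apply (simp only: linear_sum[OF l(1)] linear_sum[OF l(2)] cl_mult_assoc_axis)
    done
qed

lemma cl_mult_one: "cl_one \<odot> x = x" "x \<odot> cl_one = x"
proof -
  have l: "linear (\<lambda>x. x \<odot> y)" "linear (\<lambda>y. x \<odot> y)" for x y :: "'n::{finite,linorder} clifford"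
    using bilinear_cl_mult unfolding bilinear_def by auto
  have s: "cl_sign {} S = 1" "cl_sign S {} = 1" for S::"'n::{finite,linorder} set" by (auto simp: cl_sign_def)
  show "cl_one \<odot> x = x"
    apply (subst vec_eq_sum_axis[of x])
    apply (simp only: linear_sum[OF l(2)] cl_one_def cl_mult_axis)
    apply (simp add: s vec_eq_sum_axis[symmetric])
    done
  show "x \<odot> cl_one = x"
    apply (subst vec_eq_sum_axis[of x])
    apply (simp only: linear_sum[OF l(1)] cl_one_def cl_mult_axis)
    apply (simp add: s vec_eq_sum_axis[symmetric])
    done
qed

lemma cl_generator_relation: "axis {i} 1 \<odot> axis {j} 1 + axis {j} 1 \<odot> axis {i} 1 = (if i = j then -2 else 0) *\<^sub>R cl_one"
proof -
  have 1: "cl_sign {i} {j} = (if j \<le> i then -1 else 1)" for i j :: 'a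
    by (simp add: cl_sign_eq_prod)
  have "sym_diff {i} {j} = sym_diff {j} {i}" by auto
  then show ?thesis
    by (cases i j rule: linorder_cases) (simp_all add: cl_mult_axis 1 cl_one_def, auto simp: vec_eq_iff axis_def)
qed

lemma cl_mult_axis_ordered: "\<forall>i\<in>S. i < j \<Longrightarrow> axis S 1 \<odot> axis {j} 1 = axis (insert j S) 1"
proof -
  assume *: "\<forall>i\<in>S. i < j"
  then have "sym_diff S {j} = insert j S" by auto
  moreover have "cl_sign S {j} = 1" using * by (auto simp: cl_sign_eq_prod intro!: prod.neutral)
  ultimately show ?thesis by (simp add: cl_mult_axis)
qed

inductive_set Spin :: "('n::{finite,linorder} clifford) set" where
  one: "cl_one \<in> Spin"
| step: "g \<in> Spin \<Longrightarrow> norm u = 1 \<Longrightarrow> norm v = 1 \<Longrightarrow> g \<odot> (cl_vec u \<odot> cl_vec v) \<in> Spin"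

text \<open>
  An irreducible real module over the Clifford algebra, in an orthonormal basis for a
  scalar product that makes Clifford multiplication with vectors skew-symmetric.
\<close>

definition spin_module :: "('n::{finite,linorder} clifford \<Rightarrow> real ^ 's ^ 's) \<Rightarrow> bool" where
  "spin_module \<rho> \<longleftrightarrow>
     linear \<rho> \<and> \<rho> cl_one = mat 1 \<and> (\<forall>x y. \<rho> (x \<odot> y) = \<rho> x ** \<rho> y) \<and>
     (\<forall>V. subspace V \<and> (\<forall>x. \<forall>\<phi>\<in>V. \<rho> x *v \<phi> \<in> V) \<longrightarrow> V = {0} \<or> V = UNIV) \<and>
     (\<forall>v. transpose (\<rho> (cl_vec v)) = - \<rho> (cl_vec v))"


section \<open>Calculus on the round unit sphere\<close>

text \<open>Meant for open W only: the derivatives are taken in the ambient space.\<close>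

primrec Ck_on ::
  "nat \<Rightarrow> 'a::euclidean_space set \<Rightarrow> ('a \<Rightarrow> 'b::euclidean_space) \<Rightarrow> bool" where
  "Ck_on 0 W f \<longleftrightarrow> continuous_on W f"
| "Ck_on (Suc k) W f \<longleftrightarrow>
     f differentiable_on W \<and> (\<forall>v. Ck_on k W (\<lambda>x. frechet_derivative f (at x) v))"

abbreviation unit_sphere :: "'a::euclidean_space set" where
  "unit_sphere \<equiv> sphere 0 1"

abbreviation tangent_space :: "'a::euclidean_space \<Rightarrow> 'a set" where
  "tangent_space p \<equiv> {X. X \<bullet> p = 0}"

text \<open>
  Functions on a (relatively open) part of the sphere are differentiated by first extending
  them constantly along rays.
\<close>

definition radial_ext :: "('a::euclidean_space \<Rightarrow> 'b) \<Rightarrow> 'a \<Rightarrow> 'b" where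
  "radial_ext f x = f (x /\<^sub>R norm x)"

definition smooth_on_sphere ::
  "'a::euclidean_space set \<Rightarrow> ('a \<Rightarrow> 'b::euclidean_space) \<Rightarrow> bool" where
  "smooth_on_sphere U f \<longleftrightarrow>
     (\<forall>k. Ck_on k {x. x \<noteq> 0 \<and> x /\<^sub>R norm x \<in> U} (radial_ext f))"

definition sphere_deriv ::
  "('a::euclidean_space \<Rightarrow> 'b::euclidean_space) \<Rightarrow> 'a \<Rightarrow> 'a \<Rightarrow> 'b" where
  "sphere_deriv f p X = frechet_derivative (radial_ext f) (at p) X"

text \<open>
  The Levi-Civita derivative of a vector field Y in direction X is the tangential part of the
  Euclidean one.
\<close>

definition levi_civita ::
  "('a::euclidean_space \<Rightarrow> 'a) \<Rightarrow> 'a \<Rightarrow> 'a \<Rightarrow> 'a" where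
  "levi_civita Y p X = sphere_deriv Y p X - (sphere_deriv Y p X \<bullet> p) *\<^sub>R p"

text \<open>
  The endomorphism A p of the tangent space at p is represented by a linear map of the
  ambient space, whose values outside the tangent space are irrelevant.
\<close>

definition symmetric_endo_field :: "('a::euclidean_space \<Rightarrow> 'a \<Rightarrow> 'a) \<Rightarrow> bool" where
  "symmetric_endo_field A \<longleftrightarrow>
     (\<forall>p\<in>unit_sphere. linear (A p) \<and>
        (\<forall>X\<in>tangent_space p. A p X \<in> tangent_space p) \<and>
        (\<forall>X\<in>tangent_space p. \<forall>Y\<in>tangent_space p. A p X \<bullet> Y = X \<bullet> A p Y)) \<and>
     (\<forall>v. smooth_on_sphere unit_sphere (\<lambda>p. A p (v - (v \<bullet> p) *\<^sub>R p)))"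


section \<open>Spin structures and the spinor bundle\<close>

definition frame_coords :: "('n::finite \<Rightarrow> 'a::euclidean_space \<Rightarrow> 'a) \<Rightarrow> 'a \<Rightarrow> 'a \<Rightarrow> real ^ 'n" where
  "frame_coords e p X = (\<chi> i. X \<bullet> e i p)"

text \<open>
  A spin structure given by local data: an open cover U a, orthonormal tangent frames e a
  over U a, and a Spin-valued cocycle s a b on the overlaps that covers the transition
  functions h of the frames, that is, s * v = (h v) * s for all coordinate vectors v, where h
  maps the coordinates with respect to e b to those with respect to e a.  As h is then
  the image of s in the special orthogonal group, the frames define an orientation.
\<close>

definition spin_structure ::
  "('c \<Rightarrow> (real ^ 'm) set) \<Rightarrow> ('c \<Rightarrow> 'n::{finite,linorder} \<Rightarrow> real ^ 'm \<Rightarrow> real ^ 'm) \<Rightarrow>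
   ('c \<Rightarrow> 'c \<Rightarrow> real ^ 'm \<Rightarrow> 'n clifford) \<Rightarrow> bool" where
  "spin_structure U e s \<longleftrightarrow>
     CARD('m) = CARD('n) + 1 \<and>
     (\<Union>a. U a) = unit_sphere \<and>
     (\<forall>a. openin (top_of_set unit_sphere) (U a)) \<and>
     (\<forall>a i. smooth_on_sphere (U a) (e a i)) \<and>
     (\<forall>a. \<forall>p\<in>U a. \<forall>i j. e a i p \<in> tangent_space p \<and>
        e a i p \<bullet> e a j p = (if i = j then 1 else 0)) \<and>
     (\<forall>a b. smooth_on_sphere (U a \<inter> U b) (s a b)) \<and>
     (\<forall>a b. \<forall>p\<in>U a \<inter> U b. s a b p \<in> Spin \<and>
        (\<forall>X\<in>tangent_space p. s a b p \<odot> cl_vec (frame_coords (e b) p X) =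
           cl_vec (frame_coords (e a) p X) \<odot> s a b p)) \<and>
     (\<forall>a b c. \<forall>p\<in>U a \<inter> U b \<inter> U c. s a b p \<odot> s b c p = s a c p)"

text \<open>
  Smooth sections of the bundle associated with the spin structure and the spin module:
  psi a is the component of the section with respect to the local spin frame over U a.
\<close>

definition spinor_field ::
  "('n::{finite,linorder} clifford \<Rightarrow> real ^ 's ^ 's) \<Rightarrow>
   ('c \<Rightarrow> (real ^ 'm) set) \<Rightarrow>
   ('c \<Rightarrow> 'c \<Rightarrow> real ^ 'm \<Rightarrow> 'n clifford) \<Rightarrow>
   ('c \<Rightarrow> real ^ 'm \<Rightarrow> real ^ 's) \<Rightarrow> bool" where
  "spinor_field \<rho> U s \<psi> \<longleftrightarrow>
     (\<forall>a. smooth_on_sphere (U a) (\<psi> a)) \<and>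
     (\<forall>a b. \<forall>p\<in>U a \<inter> U b. \<psi> a p = \<rho> (s a b p) *v \<psi> b p)"

definition clifford_mult ::
  "('n::{finite,linorder} clifford \<Rightarrow> real ^ 's ^ 's) \<Rightarrow>
   ('n \<Rightarrow> real ^ 'm \<Rightarrow> real ^ 'm) \<Rightarrow> real ^ 'm \<Rightarrow> real ^ 'm \<Rightarrow> real ^ 's \<Rightarrow> real ^ 's" where
  "clifford_mult \<rho> e p X \<phi> = \<rho> (cl_vec (frame_coords e p X)) *v \<phi>"

text \<open>
  The connection induced by the Levi-Civita connection, in the local frame e:
  the lift of the connection form to the Lie algebra of the spin group gives
  d phi (X) + 1/4 * (SUM i j. g(nabla_X e_i, e_j) e_i * e_j * phi).
\<close>

definition spinor_connection ::
  "('n::{finite,linorder} clifford \<Rightarrow> real ^ 's ^ 's) \<Rightarrow>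
   ('n \<Rightarrow> real ^ 'm \<Rightarrow> real ^ 'm) \<Rightarrow>
   (real ^ 'm \<Rightarrow> real ^ 's) \<Rightarrow> real ^ 'm \<Rightarrow> real ^ 'm \<Rightarrow> real ^ 's" where
  "spinor_connection \<rho> e \<phi> p X =
     sphere_deriv \<phi> p X +
     (1 / 4) *\<^sub>R (\<Sum>i\<in>UNIV. \<Sum>j\<in>UNIV. (levi_civita (e i) p X \<bullet> e j p) *\<^sub>R
        clifford_mult \<rho> e p (e i p) (clifford_mult \<rho> e p (e j p) (\<phi> p)))"


section \<open>Generalized Killing spinors\<close>

definition generalized_killing_with ::
  "('n::{finite,linorder} clifford \<Rightarrow> real ^ 's ^ 's) \<Rightarrow>
   ('c \<Rightarrow> (real ^ 'm) set) \<Rightarrow>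
   ('c \<Rightarrow> 'n \<Rightarrow> real ^ 'm \<Rightarrow> real ^ 'm) \<Rightarrow>
   ('c \<Rightarrow> 'c \<Rightarrow> real ^ 'm \<Rightarrow> 'n clifford) \<Rightarrow>
   (real ^ 'm \<Rightarrow> real ^ 'm \<Rightarrow> real ^ 'm) \<Rightarrow>
   ('c \<Rightarrow> real ^ 'm \<Rightarrow> real ^ 's) \<Rightarrow> bool" where
  "generalized_killing_with \<rho> U e s A \<psi> \<longleftrightarrow>
     spinor_field \<rho> U s \<psi> \<and> (\<exists>a. \<exists>p\<in>U a. \<psi> a p \<noteq> 0) \<and> symmetric_endo_field A \<and>
     (\<forall>a. \<forall>p\<in>U a. \<forall>X\<in>tangent_space p.
        spinor_connection \<rho> (e a) (\<psi> a) p X = clifford_mult \<rho> (e a) p (A p X) (\<psi> a p))"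

definition generalized_killing_spinor ::
  "('n::{finite,linorder} clifford \<Rightarrow> real ^ 's ^ 's) \<Rightarrow>
   ('c \<Rightarrow> (real ^ 'm) set) \<Rightarrow>
   ('c \<Rightarrow> 'n \<Rightarrow> real ^ 'm \<Rightarrow> real ^ 'm) \<Rightarrow>
   ('c \<Rightarrow> 'c \<Rightarrow> real ^ 'm \<Rightarrow> 'n clifford) \<Rightarrow>
   ('c \<Rightarrow> real ^ 'm \<Rightarrow> real ^ 's) \<Rightarrow> bool" where
  "generalized_killing_spinor \<rho> U e s \<psi> \<longleftrightarrow> (\<exists>A. generalized_killing_with \<rho> U e s A \<psi>)"

definition killing_spinor ::
  "('n::{finite,linorder} clifford \<Rightarrow> real ^ 's ^ 's) \<Rightarrow>
   ('c \<Rightarrow> (real ^ 'm) set) \<Rightarrow>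
   ('c \<Rightarrow> 'n \<Rightarrow> real ^ 'm \<Rightarrow> real ^ 'm) \<Rightarrow>
   ('c \<Rightarrow> 'c \<Rightarrow> real ^ 'm \<Rightarrow> 'n clifford) \<Rightarrow>
   ('c \<Rightarrow> real ^ 'm \<Rightarrow> real ^ 's) \<Rightarrow> bool" where
  "killing_spinor \<rho> U e s \<psi> \<longleftrightarrow>
     (\<exists>l::real. l \<noteq> 0 \<and> generalized_killing_with \<rho> U e s (\<lambda>p X. l *\<^sub>R X) \<psi>)"

end

theory Submission
  imports Defs
begin

text \<open>
  Let \<omega> be the volume element of the Clifford algebra, which in dimension 8 is a symmetric
  involution that anticommutes with vectors, and let f = \<psi> \<bullet> \<omega> \<psi>.  Equating the mixed
  second derivatives of a generalized Killing spinor \<psi> on the unit sphere gives, for all tangent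
  vectors X and Y,

    (AY AX - AX AY) \<psi> - 1/4 (Y X - X Y) \<psi> = b \<psi>

  with some tangent vector b, which comes from the exterior derivative of A (lemma
  curvature_identity).  The proof consists in playing the two degrees of this equation against each
  other by means of \<omega>.

  Let X be an eigenvector, AX = \<mu> X, and Y orthogonal to X.  Then the left side is the product
  X Z \<psi> with Z = Y/2 - 2 \<mu> AY orthogonal to X.  Since X Z commutes and b anticommutes with \<omega>,
  pairing with the equation for \<omega> \<psi> gives (|X|^2 |Z|^2 + |b|^2) f = 0.  So at points with f \<noteq> 0 we
  get AY = Y / (4 \<mu>) for all Y orthogonal to X, and repeating the argument with such a Y in place of X
  shows A = 1/2 or A = -1/2 (lemma endomorphism_eq_half).

  The function f cannot vanish on an open set.  Its differential is df(X) = 2 (AX \<psi>) \<bullet> \<omega> \<psi>, as the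
  connection preserves \<omega>.  Because the rank 16 is twice the dimension, at points with f = 0 the
  vectors e_i \<psi> and e_i \<omega> \<psi> form an orthogonal basis, and \<omega> \<psi> has some nonzero component
  along the e_i \<psi>: there is a vector T \<noteq> 0 with (X \<psi>) \<bullet> \<omega> \<psi> = X \<bullet> T for all X.  Now df = 0
  would mean AT = 0, so that T is an eigenvector and 1/2 T Y \<psi> = b \<psi> for Y orthogonal to T; pairing
  this with Y \<omega> \<psi> yields |T|^2 |Y|^2 = 0, a contradiction (lemma vol_derivative_nonzero).  This uses \<psi> \<noteq> 0, which
  holds everywhere because |\<psi>| is constant (lemma spinor_nonzero).

  The points where A = 1/2 and those where A = -1/2 form two disjoint closed sets.  On the complement
  of their union, which is open, f vanishes; so the complement is empty, and by connectedness one of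
  the two sets is the whole sphere.

  All calculus takes place in one local frame.  Frame, spinor and endomorphism are extended constantly
  along rays, and the equation for \<psi> is differentiated on an open cone of the ambient space, where
  the curvature of the sphere appears through the derivative of the normal field x / |x|.
\<close>

section \<open>Symmetry of second derivatives\<close>

text \<open>
  The second difference is symmetric in u and v.  Applying the mean value theorem first along u and
  then along v writes it as one iterated derivative, so exchanging the directions compares the two.
\<close>

lemma second_difference_mean_value:
  fixes g :: "'a::real_normed_vector \<Rightarrow> real"
  assumes g: "\<And>y. y \<in> ball x d \<Longrightarrow> (g has_derivative g' y) (at y)"
    and g': "\<And>y. y \<in> ball x d \<Longrightarrow> ((\<lambda>z. g' z u) has_derivative h y) (at y)"
    and t: "t > 0" "t * (norm u + norm v) < d"
  obtains y where "y \<in> ball x d"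
    "g (x + t *\<^sub>R u + t *\<^sub>R v) - g (x + t *\<^sub>R u) - g (x + t *\<^sub>R v) + g x = t\<^sup>2 * h y v"
proof -
  have in_ball: "x + a *\<^sub>R u + b *\<^sub>R v \<in> ball x d" if "0 \<le> a" "a \<le> t" "0 \<le> b" "b \<le> t" for a b
  proof -
    have "norm (a *\<^sub>R u + b *\<^sub>R v) \<le> a * norm u + b * norm v"
      using norm_triangle_ineq[of "a *\<^sub>R u" "b *\<^sub>R v"] that by simp
    also have "\<dots> \<le> t * norm u + t * norm v"
      using that by (intro add_mono mult_right_mono) auto
    also have "\<dots> < d" using t by (simp add: algebra_simps)
    finally have "norm (a *\<^sub>R u + b *\<^sub>R v) < d" .
    moreover have "dist x (x + a *\<^sub>R u + b *\<^sub>R v) = norm (a *\<^sub>R u + b *\<^sub>R v)"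
      by (metis add.assoc add_diff_cancel_left' dist_commute dist_norm)
    ultimately show ?thesis by simp
  qed
  have path: "((\<lambda>r. y + r *\<^sub>R w) has_derivative (\<lambda>r. r *\<^sub>R w)) (at r within S)"
    "((\<lambda>r. y + r *\<^sub>R w + z) has_derivative (\<lambda>r. r *\<^sub>R w)) (at r within S)" for y w z :: 'a and r S
    by (auto intro!: derivative_eq_intros)
  let ?G = "\<lambda>a. g (x + a *\<^sub>R u + t *\<^sub>R v) - g (x + a *\<^sub>R u)"
  have dG: "(?G has_derivative (\<lambda>r. g' (x + a *\<^sub>R u + t *\<^sub>R v) (r *\<^sub>R u) - g' (x + a *\<^sub>R u) (r *\<^sub>R u)))
      (at a within S)" if a: "0 \<le> a" "a \<le> t" for a S
    using in_ball[of a t] in_ball[of a 0] a t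
    by (intro has_derivative_diff has_derivative_compose[OF path(1) g] has_derivative_compose[OF path(2) g]) auto
  obtain a where a: "a \<in> {0<..<t}" and
    "?G t - ?G 0 = g' (x + a *\<^sub>R u + t *\<^sub>R v) ((t - 0) *\<^sub>R u) - g' (x + a *\<^sub>R u) ((t - 0) *\<^sub>R u)"
    using mvt_simple[OF t(1) dG] by auto
  moreover have "linear (g' (x + a *\<^sub>R u + t *\<^sub>R v))" "linear (g' (x + a *\<^sub>R u))"
    using in_ball[of a t] in_ball[of a 0] a t by (auto intro!: has_derivative_linear g)
  ultimately have 1: "?G t - ?G 0 = t * (g' (x + a *\<^sub>R u + t *\<^sub>R v) u - g' (x + a *\<^sub>R u) u)"
    by (simp add: linear_cmul algebra_simps)
  let ?H = "\<lambda>b. g' (x + a *\<^sub>R u + b *\<^sub>R v) u"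
  have dH: "(?H has_derivative (\<lambda>r. h (x + a *\<^sub>R u + b *\<^sub>R v) (r *\<^sub>R v))) (at b within S)"
    if b: "0 \<le> b" "b \<le> t" for b S
    using in_ball[of a b] a b by (intro has_derivative_compose[OF path(1) g']) auto
  obtain b where b: "b \<in> {0<..<t}" and
    "?H t - ?H 0 = h (x + a *\<^sub>R u + b *\<^sub>R v) ((t - 0) *\<^sub>R v)"
    using mvt_simple[OF t(1) dH] by auto
  moreover have "linear (h (x + a *\<^sub>R u + b *\<^sub>R v))"
    using in_ball[of a b] a b by (auto intro!: has_derivative_linear g')
  ultimately have 2: "?H t - ?H 0 = t * h (x + a *\<^sub>R u + b *\<^sub>R v) v"
    by (simp add: linear_cmul)
  show thesis
  proof (rule that)
    show "x + a *\<^sub>R u + b *\<^sub>R v \<in> ball x d" using in_ball[of a b] a b by auto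
    show "g (x + t *\<^sub>R u + t *\<^sub>R v) - g (x + t *\<^sub>R u) - g (x + t *\<^sub>R v) + g x
        = t\<^sup>2 * h (x + a *\<^sub>R u + b *\<^sub>R v) v"
      using 1 2 by (simp add: power2_eq_square)
  qed
qed

lemma mixed_derivatives_commute_real:
  fixes g :: "'a::real_normed_vector \<Rightarrow> real"
  assumes W: "open W" "x \<in> W"
    and g: "\<And>y. y \<in> W \<Longrightarrow> (g has_derivative g' y) (at y)"
    and hu: "\<And>y. y \<in> W \<Longrightarrow> ((\<lambda>z. g' z u) has_derivative hu y) (at y)"
    and hv: "\<And>y. y \<in> W \<Longrightarrow> ((\<lambda>z. g' z v) has_derivative hv y) (at y)"
    and cont: "isCont (\<lambda>y. hu y v) x" "isCont (\<lambda>y. hv y u) x"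
  shows "hu x v = hv x u"
proof (rule ccontr)
  assume ne: "hu x v \<noteq> hv x u"
  define \<epsilon> where "\<epsilon> = \<bar>hu x v - hv x u\<bar> / 2"
  have "\<epsilon> > 0" using ne by (simp add: \<epsilon>_def)
  obtain d0 where d0: "d0 > 0" "ball x d0 \<subseteq> W" using W by (meson open_contains_ball)
  obtain d1 where d1: "d1 > 0" "\<And>y. dist y x < d1 \<Longrightarrow> dist (hu y v) (hu x v) < \<epsilon>"
    using cont(1) \<open>\<epsilon> > 0\<close> unfolding continuous_at_eps_delta by blast
  obtain d2 where d2: "d2 > 0" "\<And>y. dist y x < d2 \<Longrightarrow> dist (hv y u) (hv x u) < \<epsilon>"
    using cont(2) \<open>\<epsilon> > 0\<close> unfolding continuous_at_eps_delta by blast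
  define d where "d = min d0 (min d1 d2)"
  define t where "t = d / (norm u + norm v + 1)"
  have d: "d > 0" "ball x d \<subseteq> W" using d0 d1 d2 by (auto simp: d_def)
  have t: "t > 0" "t * (norm u + norm v) < d" "t * (norm v + norm u) < d"
  proof -
    have p: "norm u + norm v + 1 > 0" by (simp add: add_nonneg_pos)
    then show "t > 0" using d by (simp add: t_def)
    then have "t * (norm u + norm v) < t * (norm u + norm v + 1)" by simp
    also have "\<dots> = d" using p by (simp add: t_def)
    finally show "t * (norm u + norm v) < d" "t * (norm v + norm u) < d" by (simp_all add: add.commute)
  qed
  obtain y where y: "y \<in> ball x d"
    "g (x + t *\<^sub>R u + t *\<^sub>R v) - g (x + t *\<^sub>R u) - g (x + t *\<^sub>R v) + g x = t\<^sup>2 * hu y v"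
    by (rule second_difference_mean_value[of x d g g' u hu t v]) (use d t g hu in auto)
  obtain z where z: "z \<in> ball x d"
    "g (x + t *\<^sub>R v + t *\<^sub>R u) - g (x + t *\<^sub>R v) - g (x + t *\<^sub>R u) + g x = t\<^sup>2 * hv z u"
    by (rule second_difference_mean_value[of x d g g' v hv t u]) (use d t g hv in auto)
  have "t\<^sup>2 * hu y v = t\<^sup>2 * hv z u"
    unfolding y(2)[symmetric] z(2)[symmetric] by (simp add: add_ac)
  then have "hu y v = hv z u" using t by simp
  moreover have "\<bar>hu y v - hu x v\<bar> < \<epsilon>" "\<bar>hv z u - hv x u\<bar> < \<epsilon>"
    using d1(2)[of y] d2(2)[of z] y z by (auto simp: d_def dist_real_def dist_commute)
  ultimately show False unfolding \<epsilon>_def by (auto simp: abs_if split: if_splits)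
qed

text \<open>
  The only place where the flatness of the ambient space enters: both the curvature of the frame
  and the integrability condition of the spinor equation are instances of this symmetry.
\<close>

lemma Ck_on_2_mixed_derivatives_commute:
  fixes f :: "'a::euclidean_space \<Rightarrow> 'b::euclidean_space"
  assumes W: "open W" "x \<in> W" and f: "Ck_on 2 W f"
  shows "frechet_derivative (\<lambda>y. frechet_derivative f (at y) u) (at x) v =
         frechet_derivative (\<lambda>y. frechet_derivative f (at y) v) (at x) u"
proof (rule euclidean_eqI)
  fix b :: 'b assume "b \<in> Basis"
  have 1: "f differentiable (at y)" "(\<lambda>y. frechet_derivative f (at y) w) differentiable (at y)" if "y \<in> W" for y w
    using f that by (simp_all add: numeral_2_eq_2 differentiable_on_eq_differentiable_at[OF W(1)])
  have d1: "((\<lambda>y. f y \<bullet> b) has_derivative (\<lambda>w. frechet_derivative f (at y) w \<bullet> b)) (at y)" if "y \<in> W" for y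
    using 1(1)[OF that] by (auto simp: frechet_derivative_works intro!: derivative_eq_intros)
  have d2: "((\<lambda>y. frechet_derivative f (at y) w \<bullet> b) has_derivative
      (\<lambda>w'. frechet_derivative (\<lambda>y. frechet_derivative f (at y) w) (at y) w' \<bullet> b)) (at y)" if "y \<in> W" for y w
    using 1(2)[OF that] by (auto simp: frechet_derivative_works intro!: derivative_eq_intros)
  have c: "isCont (\<lambda>y. frechet_derivative (\<lambda>y. frechet_derivative f (at y) w) (at y) w' \<bullet> b) x" for w w'
    using f W by (auto simp: numeral_2_eq_2 continuous_on_eq_continuous_at)
  show "frechet_derivative (\<lambda>y. frechet_derivative f (at y) u) (at x) v \<bullet> b =
         frechet_derivative (\<lambda>y. frechet_derivative f (at y) v) (at x) u \<bullet> b"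
    by (rule mixed_derivatives_commute_real[OF W d1 d2 d2 c c])
qed

lemma Ck_on_cong:
  assumes "open W" "\<And>x. x \<in> W \<Longrightarrow> f x = g x" "Ck_on k W f"
  shows "Ck_on k W g"
  using assms(2,3)
proof (induction k arbitrary: f g)
  case 0
  then show ?case by (simp cong: continuous_on_cong)
next
  case (Suc k)
  have d: "(f has_derivative D) (at x) \<longleftrightarrow> (g has_derivative D) (at x)" if "x \<in> W" for x D
    using Suc.prems(1) that assms(1) by (metis has_derivative_transform_within_open)
  have "frechet_derivative f (at x) v = frechet_derivative g (at x) v" if "x \<in> W" for x v
    unfolding frechet_derivative_def by (simp add: d[OF that])
  moreover have "g differentiable_on W"
    using Suc.prems(2) d by (simp add: differentiable_on_eq_differentiable_at[OF assms(1)] differentiable_def)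
  moreover have "Ck_on k W (\<lambda>x. frechet_derivative f (at x) v)" for v
    using Suc.prems(2) by simp
  ultimately show ?case using Suc.IH by (metis (no_types, lifting) Ck_on.simps(2))
qed

section \<open>The curvature condition in one fibre\<close>

lemma orthogonal_family_card_le:
  fixes f :: "'i \<Rightarrow> 'a::euclidean_space"
  assumes fin: "finite I" and nz: "\<And>i. i \<in> I \<Longrightarrow> f i \<noteq> 0"
    and orth: "\<And>i j. i \<in> I \<Longrightarrow> j \<in> I \<Longrightarrow> i \<noteq> j \<Longrightarrow> f i \<bullet> f j = 0"
  shows "card I \<le> DIM('a)"
proof -
  have inj: "inj_on f I"
    by (rule inj_onI) (metis inner_eq_zero_iff nz orth)
  have "pairwise orthogonal (f ` I)"
    using orth by (auto simp: pairwise_def orthogonal_def)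
  moreover have "0 \<notin> f ` I" using nz by force
  ultimately have "independent (f ` I)" by (rule pairwise_orthogonal_independent)
  then show ?thesis
    using independent_bound card_image[OF inj] by metis
qed

text \<open>
  A maximiser x of the quadratic form on the unit sphere, with maximum mu, is an eigenvector:
  B = mu - A is positive semidefinite with B(x) orthogonal to x, and if y were not orthogonal to
  B(x), moving from x along y would make the form of B negative.
\<close>

lemma symmetric_linear_eigenvector:
  fixes A :: "'a::euclidean_space \<Rightarrow> 'a"
  assumes lin: "linear A" and sym: "\<And>x y. A x \<bullet> y = x \<bullet> A y"
  obtains x \<mu> where "norm x = 1" "A x = \<mu> *\<^sub>R x"
proof -
  have "continuous_on (sphere 0 1) (\<lambda>x. x \<bullet> A x)"
    by (intro continuous_intros linear_continuous_on lin[THEN linear_conv_bounded_linear[THEN iffD1]])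
  moreover have "(SOME b. b \<in> Basis) \<in> sphere (0::'a) 1"
    by (simp add: SOME_Basis)
  ultimately obtain x where x: "x \<in> sphere 0 1" and
    max: "\<And>y. y \<in> sphere 0 1 \<Longrightarrow> y \<bullet> A y \<le> x \<bullet> A x"
    using continuous_attains_sup[of "sphere (0::'a) 1" "\<lambda>x. x \<bullet> A x"] by auto
  define \<mu> where "\<mu> = x \<bullet> A x"
  define B where "B y = \<mu> *\<^sub>R y - A y" for y
  have linB: "linear B" unfolding B_def using lin
    by (intro linear_compose_sub linear_compose_scale_right) (auto simp: linear_ident)
  have symB: "B y \<bullet> z = y \<bullet> B z" for y z by (simp add: B_def inner_diff sym)
  have pos: "y \<bullet> B y \<ge> 0" for y
  proof (cases "y = 0")
    case False
    have "(y /\<^sub>R norm y) \<bullet> A (y /\<^sub>R norm y) \<le> \<mu>"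
      using False max[of "y /\<^sub>R norm y"] by (simp add: \<mu>_def)
    then have "(y \<bullet> A y) / (norm y * norm y) \<le> \<mu>"
      by (simp add: linear_cmul[OF lin] divide_simps)
    then show ?thesis using False
      by (simp add: B_def inner_diff divide_simps dot_square_norm power2_eq_square mult.commute)
  qed (simp add: B_def)
  have "x \<bullet> B x = 0" using x by (simp add: B_def inner_diff \<mu>_def dot_square_norm)
  have zero: "y \<bullet> B x = 0" for y
  proof (rule ccontr)
    assume ne: "y \<bullet> B x \<noteq> 0"
    \<comment> \<open>The parabola 2 t (y.Bx) + t^2 (y.By) is negative here; the 1 keeps the denominator positive.\<close>
    define t where "t = - (y \<bullet> B x) / (y \<bullet> B y + 1)"
    have "(x + t *\<^sub>R y) \<bullet> B (x + t *\<^sub>R y) = 2 * t * (y \<bullet> B x) + t\<^sup>2 * (y \<bullet> B y)"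
      using symB[of y x] \<open>x \<bullet> B x = 0\<close>
      by (simp add: linear_add[OF linB] linear_cmul[OF linB] inner_add power2_eq_square algebra_simps inner_commute)
    also have "\<dots> = t * (2 * (y \<bullet> B x) + t * (y \<bullet> B y))" by (simp add: power2_eq_square algebra_simps)
    also have "2 * (y \<bullet> B x) + t * (y \<bullet> B y) = (y \<bullet> B x) * (2 - (y \<bullet> B y) / (y \<bullet> B y + 1))"
      using pos[of y] by (simp add: t_def divide_simps) (simp add: algebra_simps)
    also have "t * \<dots> = - ((y \<bullet> B x)\<^sup>2 / (y \<bullet> B y + 1)) * (2 - (y \<bullet> B y) / (y \<bullet> B y + 1))"
      by (simp add: t_def power2_eq_square)
    also have "\<dots> < 0"
      using pos[of y] ne by (intro mult_neg_pos) (auto simp: divide_simps)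
    finally show False using pos[of "x + t *\<^sub>R y"] by simp
  qed
  have "B x = 0" using zero[of "B x"] by simp
  then show thesis using that[of x \<mu>] x by (simp add: B_def)
qed

text \<open>
  One fibre of the spinor bundle in dimension 0 mod 4: Clifford multiplication c together with the
  action \<omega> of the volume element, whose eigenspaces are the two half-spinor spaces.
\<close>

locale graded_clifford_module =
  fixes c :: "'v::euclidean_space \<Rightarrow> 's::euclidean_space \<Rightarrow> 's" and \<omega> :: "'s \<Rightarrow> 's"
  assumes bilin: "bilinear c"
    and skew: "c x \<phi> \<bullet> \<phi>' = - (\<phi> \<bullet> c x \<phi>')"
    and square: "c x (c x \<phi>) = - (x \<bullet> x) *\<^sub>R \<phi>"
    and linear_vol: "linear \<omega>"
    and vol_sym: "\<omega> \<phi> \<bullet> \<phi>' = \<phi> \<bullet> \<omega> \<phi>'"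
    and vol_square: "\<omega> (\<omega> \<phi>) = \<phi>"
    and vol_anticommute: "\<omega> (c x \<phi>) = - c x (\<omega> \<phi>)"
begin

lemmas c_simps = bilinear_ladd[OF bilin] bilinear_radd[OF bilin] bilinear_lmul[OF bilin]
  bilinear_rmul[OF bilin] bilinear_lneg[OF bilin] bilinear_rneg[OF bilin]
  bilinear_lsub[OF bilin] bilinear_rsub[OF bilin] bilinear_lzero[OF bilin] bilinear_rzero[OF bilin]

lemmas vol_simps = linear_add[OF linear_vol] linear_cmul[OF linear_vol] linear_0[OF linear_vol]
  linear_neg[OF linear_vol] linear_diff[OF linear_vol]

lemma clifford_relation: "c x (c y \<phi>) + c y (c x \<phi>) = - (2 * (x \<bullet> y)) *\<^sub>R \<phi>"
proof -
  have "c (x + y) (c (x + y) \<phi>) = - ((x + y) \<bullet> (x + y)) *\<^sub>R \<phi>" by (rule square)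
  then have "c x (c y \<phi>) + c y (c x \<phi>) + (2 * (x \<bullet> y)) *\<^sub>R \<phi> = 0"
    by (simp add: c_simps square inner_add inner_commute algebra_simps)
  then show ?thesis by (simp add: eq_neg_iff_add_eq_0)
qed

lemma anticommute: "x \<bullet> y = 0 \<Longrightarrow> c x (c y \<phi>) = - c y (c x \<phi>)"
  using clifford_relation[of x y \<phi>] by (simp add: eq_neg_iff_add_eq_0)

lemma c_self_orthogonal: "c x \<phi> \<bullet> \<phi> = 0"
  using skew[of x \<phi> \<phi>] by (simp add: inner_commute)

lemma inner_c_same: "c x \<phi> \<bullet> c x \<phi>' = (x \<bullet> x) * (\<phi> \<bullet> \<phi>')"
  by (simp add: skew square)

text \<open>
  The commutator x y - y x is skew and commutes with \<omega>, which is symmetric, so this form is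
  symmetric in x and y; its symmetric part is given by the Clifford relation.
\<close>

lemma inner_c_vol: "c x \<psi> \<bullet> c y (\<omega> \<psi>) = (x \<bullet> y) * (\<psi> \<bullet> \<omega> \<psi>)"
proof -
  have sym: "c x \<psi> \<bullet> c y (\<omega> \<psi>) = c y \<psi> \<bullet> c x (\<omega> \<psi>)" for x y
  proof -
    have "c x \<psi> \<bullet> c y (\<omega> \<psi>) = - (\<omega> (c x \<psi>) \<bullet> c y \<psi>)"
      by (metis vol_anticommute vol_sym inner_minus_right minus_minus)
    also have "\<dots> = c y \<psi> \<bullet> c x (\<omega> \<psi>)"
      by (simp add: vol_anticommute inner_commute)
    finally show ?thesis .
  qed
  have "2 * (c x \<psi> \<bullet> c y (\<omega> \<psi>)) = c x \<psi> \<bullet> c y (\<omega> \<psi>) + c y \<psi> \<bullet> c x (\<omega> \<psi>)"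
    using sym[of x y] by simp
  also have "\<dots> = - ((c y (c x \<psi>) + c x (c y \<psi>)) \<bullet> \<omega> \<psi>)"
    by (simp add: skew inner_add_left)
  also have "\<dots> = 2 * ((x \<bullet> y) * (\<psi> \<bullet> \<omega> \<psi>))"
    by (simp add: clifford_relation inner_commute)
  finally show ?thesis by simp
qed

text \<open>
  The part of the integrability condition of the equation "derivative of \<psi> along x is A x times
  \<psi>" on the unit sphere that is quadratic in vectors.  All other terms of that condition are single
  vectors acting on \<psi>.
\<close>

definition spinor_curvature :: "('v \<Rightarrow> 'v) \<Rightarrow> 'v \<Rightarrow> 'v \<Rightarrow> 's \<Rightarrow> 's" where
  "spinor_curvature A x y \<psi> = c (A y) (c (A x) \<psi>) - c (A x) (c (A y) \<psi>)
     - (1 / 4) *\<^sub>R (c y (c x \<psi>) - c x (c y \<psi>))"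

text \<open>
  Since x z commutes and b anticommutes with \<omega>, also x z \<omega> \<psi> = - b \<omega> \<psi>.  Pairing this with
  x z \<psi> = b \<psi> gives |x|^2 |z|^2 f = - |b|^2 f for f the inner product of \<psi> with \<omega> \<psi>.
\<close>

lemma bivector_annihilates:
  assumes "x \<bullet> z = 0" "c x (c z \<psi>) = c b \<psi>" "\<psi> \<bullet> \<omega> \<psi> \<noteq> 0" "x \<noteq> 0"
  shows "z = 0"
proof -
  have "c x (c z (\<omega> \<psi>)) = \<omega> (c x (c z \<psi>))" by (simp add: vol_anticommute c_simps)
  also have "\<dots> = - c b (\<omega> \<psi>)" by (simp add: assms vol_anticommute)
  finally have *: "c x (c z (\<omega> \<psi>)) = - c b (\<omega> \<psi>)" .
  have "(x \<bullet> x) * (z \<bullet> z) * (\<psi> \<bullet> \<omega> \<psi>) = c x (c z \<psi>) \<bullet> c x (c z (\<omega> \<psi>))"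
    by (simp add: inner_c_same)
  also have "\<dots> = - ((b \<bullet> b) * (\<psi> \<bullet> \<omega> \<psi>))" unfolding * assms by (simp add: inner_c_same)
  finally have "((x \<bullet> x) * (z \<bullet> z) + b \<bullet> b) * (\<psi> \<bullet> \<omega> \<psi>) = 0" by (simp add: algebra_simps)
  then have "(x \<bullet> x) * (z \<bullet> z) + b \<bullet> b = 0" using assms by simp
  moreover have "(x \<bullet> x) * (z \<bullet> z) \<ge> 0" "b \<bullet> b \<ge> 0" by simp_all
  ultimately have "(x \<bullet> x) * (z \<bullet> z) = 0" by linarith
  then show ?thesis using assms by simp
qed

text \<open>
  Along an eigenvector the curvature is a single product of two orthogonal vectors, instead of a
  sum of several.
\<close>

lemma curvature_at_eigenvector:
  assumes sym: "A x = \<mu> *\<^sub>R x" "x \<bullet> y = 0" "x \<bullet> A y = 0"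
  shows "spinor_curvature A x y \<psi> = c x (c ((1 / 2) *\<^sub>R y - (2 * \<mu>) *\<^sub>R A y) \<psi>)"
proof -
  have "c y (c x \<psi>) = - c x (c y \<psi>)" "c (A y) (c x \<psi>) = - c x (c (A y) \<psi>)"
    using anticommute[of y x] anticommute[of "A y" x] assms by (simp_all add: inner_commute)
  then show ?thesis unfolding spinor_curvature_def assms(1)
    by (simp add: c_simps scaleR_diff_right) (simp add: algebra_simps flip: scaleR_left_distrib)
qed

text \<open>
  Writing mu for the eigenvalue of an eigenvector x, the two preceding lemmas force
  A = 1 / (4 mu) on the complement of x.  Doing the same with an eigenvector y from this complement
  and a third vector z orthogonal to both gives (1 / (4 mu))^2 = 1/4.
\<close>

lemma endomorphism_eq_half:
  assumes dim: "DIM('v) \<ge> 3"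
    and lin: "linear A" and sym: "\<And>x y. A x \<bullet> y = x \<bullet> A y"
    and curv: "\<And>x y. \<exists>b. spinor_curvature A x y \<psi> = c b \<psi>"
    and ne: "\<psi> \<bullet> \<omega> \<psi> \<noteq> 0"
  shows "\<exists>\<mu>\<in>{1/2, -1/2}. \<forall>x. A x = \<mu> *\<^sub>R x"
proof -
  have key: "y = (4 * \<mu>) *\<^sub>R A y" if "A x = \<mu> *\<^sub>R x" "x \<noteq> 0" "x \<bullet> y = 0" for x y \<mu>
  proof -
    have "x \<bullet> A y = 0" using that sym[of x y] by simp
    moreover obtain b where "spinor_curvature A x y \<psi> = c b \<psi>" using curv by blast
    ultimately have "(1 / 2) *\<^sub>R y - (2 * \<mu>) *\<^sub>R A y = 0"
      using curvature_at_eigenvector[of A x \<mu> y, OF that(1,3)] that(2,3) ne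
      by (intro bivector_annihilates[of x _ \<psi> b]) (auto simp: inner_diff)
    then have "2 *\<^sub>R ((1 / 2) *\<^sub>R y) = 2 *\<^sub>R ((2 * \<mu>) *\<^sub>R A y)" by simp
    then show ?thesis by simp
  qed
  obtain x \<mu> where x: "norm x = 1" "A x = \<mu> *\<^sub>R x" using symmetric_linear_eigenvector[OF lin sym] .
  then have "x \<noteq> 0" by auto
  have "dim {x} < DIM('v)" using dim dim_le_card'[of "{x}"] by simp
  then obtain y where y: "y \<noteq> 0" "x \<bullet> y = 0"
    by (metis orthogonal_to_subspace_exists orthogonal_def inner_commute span_base insertI1)
  have "dim {x, y} < DIM('v)" using dim dim_le_card'[of "{x, y}"] card_insert_le_m1[of 2 "{y}" x] by simp
  then obtain z where z: "z \<noteq> 0" "x \<bullet> z = 0" "y \<bullet> z = 0"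
    by (metis orthogonal_to_subspace_exists orthogonal_def inner_commute span_base insertI1 insertI2)
  have "\<mu> \<noteq> 0" using key[OF x(2) \<open>x \<noteq> 0\<close> y(2)] y(1) by auto
  define \<nu> where "\<nu> = 1 / (4 * \<mu>)"
  have A: "A w = \<nu> *\<^sub>R w" if "x \<bullet> w = 0" for w
  proof -
    have "\<nu> *\<^sub>R w = \<nu> *\<^sub>R ((4 * \<mu>) *\<^sub>R A w)" using key[OF x(2) \<open>x \<noteq> 0\<close> that] by simp
    then show ?thesis using \<open>\<mu> \<noteq> 0\<close> by (simp add: \<nu>_def)
  qed
  have "z = (4 * \<nu>) *\<^sub>R (\<nu> *\<^sub>R z)" using key[OF A[OF y(2)] y(1) z(3)] A[OF z(2)] by simp
  then have "1 *\<^sub>R z = (4 * \<nu> * \<nu>) *\<^sub>R z" by simp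
  then have \<nu>: "4 * \<nu> * \<nu> = 1" using z(1) by (metis scaleR_cancel_right)
  then have "4 * \<mu> * \<nu> = 4 * \<nu> * \<nu>" using \<open>\<mu> \<noteq> 0\<close> by (simp add: \<nu>_def)
  then have "\<nu> = 0 \<or> \<mu> = \<nu>" by simp
  then have "\<mu> = \<nu>" using \<nu> by auto
  have "(2 * \<nu> - 1) * (2 * \<nu> + 1) = 0" using \<nu> by (simp add: algebra_simps)
  then have half: "\<nu> = 1/2 \<or> \<nu> = -1/2" by auto
  have "A w = \<nu> *\<^sub>R w" for w
  proof -
    have "A (w - (x \<bullet> w) *\<^sub>R x) = \<nu> *\<^sub>R (w - (x \<bullet> w) *\<^sub>R x)"
      using x(1) by (intro A) (simp add: inner_diff dot_square_norm)
    then show ?thesis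
      using x(2) \<open>\<mu> = \<nu>\<close> by (simp add: linear_diff[OF lin] linear_cmul[OF lin] algebra_simps)
  qed
  then show ?thesis using half by auto
qed

text \<open>
  When f vanishes, the vectors b \<psi> and b (\<omega> \<psi>), for b in an orthonormal basis, are pairwise
  orthogonal and fill the module for dimension reasons.  Now \<omega> \<psi> is nonzero and, by skewness,
  orthogonal to all b (\<omega> \<psi>), so it cannot be orthogonal to all b \<psi> as well.
\<close>

lemma vol_component_nonzero:
  assumes dim: "DIM('s) = 2 * DIM('v)" and ne: "\<psi> \<noteq> 0" and zero: "\<psi> \<bullet> \<omega> \<psi> = 0"
  shows "\<exists>x. c x \<psi> \<bullet> \<omega> \<psi> \<noteq> 0"
proof (rule ccontr)
  assume "\<not> ?thesis"
  then have perp: "c x \<psi> \<bullet> \<omega> \<psi> = 0" for x by simp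
  have vol_ne: "\<omega> \<psi> \<noteq> 0" using ne vol_square[of \<psi>] by (auto simp: vol_simps)
  have orth: "c x \<phi> \<bullet> c y \<phi> = 0" if "x \<bullet> y = 0" for x y \<phi>
  proof -
    have "c x \<phi> \<bullet> c y \<phi> = - (\<phi> \<bullet> c x (c y \<phi>))" "c x \<phi> \<bullet> c y \<phi> = - (\<phi> \<bullet> c y (c x \<phi>))"
      by (metis skew) (metis skew inner_commute)
    moreover have "c x (c y \<phi>) = - c y (c x \<phi>)" using that by (rule anticommute)
    ultimately show ?thesis by simp
  qed
  have nz: "c b \<phi> \<noteq> 0" if "b \<in> Basis" "\<phi> \<noteq> 0" for b \<phi>
    using square[of b \<phi>] that by (auto simp: c_simps)
  \<comment> \<open>One orthogonal vector too many: the index None stands for the additional vector.\<close>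
  define F where "F = (\<lambda>i :: bool \<times> 'v option. case i of
      (s, None) \<Rightarrow> \<omega> \<psi> | (True, Some b) \<Rightarrow> c b \<psi> | (False, Some b) \<Rightarrow> c b (\<omega> \<psi>))"
  define I where "I = insert (True, None) (UNIV \<times> Some ` (Basis :: 'v set))"
  have "card I \<le> DIM('s)"
  proof (rule orthogonal_family_card_le[of I F])
    show "finite I" by (simp add: I_def)
    show "F i \<noteq> 0" if "i \<in> I" for i
      using that nz vol_ne ne by (auto simp: I_def F_def split: bool.splits option.splits)
    show "F i \<bullet> F j = 0" if "i \<in> I" "j \<in> I" "i \<noteq> j" for i j
      using that perp c_self_orthogonal orth[OF inner_not_same_Basis] inner_c_vol[of _ \<psi>] zero
      by (fastforce simp: I_def F_def inner_commute split: bool.splits option.splits)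
  qed
  moreover have "card I = 2 * DIM('v) + 1"
    by (subst I_def, subst card_insert_disjoint) (auto simp: card_cartesian_product card_image)
  ultimately show False using dim by simp
qed

text \<open>
  The gradient of f is 2 A t, where t is the vector that represents the functional of the previous
  lemma.  If A t = 0, then t is an eigenvector and the curvature in the directions t and y is
  1/2 t y \<psi> = b \<psi>; paired with y (\<omega> \<psi>) the left side is nonzero, while the right side is a
  multiple of f = 0.
\<close>

lemma vol_derivative_nonzero:
  assumes dim: "DIM('s) = 2 * DIM('v)" "DIM('v) \<ge> 2"
    and sym: "\<And>x y. A x \<bullet> y = x \<bullet> A y"
    and curv: "\<And>x y. \<exists>b. spinor_curvature A x y \<psi> = c b \<psi>"
    and ne: "\<psi> \<noteq> 0" and zero: "\<psi> \<bullet> \<omega> \<psi> = 0"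
  shows "\<exists>x. c (A x) \<psi> \<bullet> \<omega> \<psi> \<noteq> 0"
proof (rule ccontr)
  assume "\<not> ?thesis"
  then have perp: "c (A x) \<psi> \<bullet> \<omega> \<psi> = 0" for x by simp
  define t where "t = (\<Sum>b\<in>Basis. (c b \<psi> \<bullet> \<omega> \<psi>) *\<^sub>R b)"
  have lin: "linear (\<lambda>x. c x \<psi> \<bullet> \<omega> \<psi>)"
    by (rule linearI) (simp_all add: c_simps inner_add)
  have t: "c x \<psi> \<bullet> \<omega> \<psi> = x \<bullet> t" for x
  proof -
    have "c x \<psi> \<bullet> \<omega> \<psi> = (\<Sum>b\<in>Basis. (x \<bullet> b) * (c b \<psi> \<bullet> \<omega> \<psi>))"
      using linear_sum[OF lin, of "\<lambda>b. (x \<bullet> b) *\<^sub>R b" Basis]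
      by (simp add: euclidean_representation linear_cmul[OF lin])
    then show ?thesis by (simp add: t_def inner_sum_right mult.commute)
  qed
  have "t \<noteq> 0" using vol_component_nonzero[OF dim(1) ne zero] t by auto
  have "A t \<bullet> x = 0" for x using perp[of x] t[of "A x"] sym[of x t] by (simp add: sym inner_commute)
  then have At: "A t = 0 *\<^sub>R t" by (metis inner_eq_zero_iff scaleR_zero_left)
  have "dim {t} < DIM('v)" using dim dim_le_card'[of "{t}"] by simp
  then obtain y where y: "y \<noteq> 0" "t \<bullet> y = 0"
    by (metis orthogonal_to_subspace_exists orthogonal_def inner_commute span_base insertI1)
  obtain b where "spinor_curvature A t y \<psi> = c b \<psi>" using curv by blast
  moreover have "spinor_curvature A t y \<psi> = (1 / 2) *\<^sub>R c t (c y \<psi>)"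
    using curvature_at_eigenvector[of A t 0 y, OF At y(2)] sym[of t y] At by (simp add: c_simps)
  ultimately have "(1 / 2) *\<^sub>R c t (c y \<psi>) = c b \<psi>" by simp
  then have "2 *\<^sub>R ((1 / 2) *\<^sub>R c t (c y \<psi>)) = 2 *\<^sub>R c b \<psi>" by simp
  then have b: "c t (c y \<psi>) = c (2 *\<^sub>R b) \<psi>" by (simp add: c_simps)
  have "0 = c (2 *\<^sub>R b) \<psi> \<bullet> c y (\<omega> \<psi>)" using zero by (simp add: inner_c_vol)
  also have "\<dots> = - (c y (c t \<psi>) \<bullet> c y (\<omega> \<psi>))"
    unfolding b[symmetric] using anticommute[OF y(2)] by simp
  also have "\<dots> = - ((y \<bullet> y) * (t \<bullet> t))" by (simp add: inner_c_same t)
  finally show False using y(1) \<open>t \<noteq> 0\<close> by simp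
qed

end

section \<open>The volume element in a spin module\<close>

lemma cl_mult_linear: "linear (\<lambda>x. x \<odot> y)" "linear (\<lambda>y. x \<odot> y)"
  using bilinear_cl_mult unfolding bilinear_def by auto

lemma linear_cl_vec: "linear (cl_vec :: real ^ 'n::{finite,linorder} \<Rightarrow> 'n clifford)"
  by (rule linearI) (auto simp: cl_vec_def vec_eq_iff axis_def algebra_simps sum.distrib[symmetric] sum_distrib_left intro!: sum.cong)

lemma cl_vec_axis: "cl_vec (axis i a) = axis {i} a"
proof -
  have "cl_vec (axis i a) = (\<Sum>j\<in>UNIV. if j = i then axis {i} a else 0)"
    unfolding cl_vec_def by (intro sum.cong refl) (auto simp: axis_def vec_eq_iff)
  then show ?thesis by simp
qed

lemma cl_vec_square: "cl_vec v \<odot> cl_vec v = - (v \<bullet> v) *\<^sub>R cl_one"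
proof -
  have gen: "axis {i} a \<odot> axis {j} b + axis {j} b \<odot> axis {i} a = (if i = j then - 2 * a * b else 0) *\<^sub>R cl_one"
    for i j :: 'a and a b
  proof -
    have ax: "axis {k} r = r *\<^sub>R axis {k} (1::real)" for k :: 'a and r by (simp add: vec_eq_iff axis_def)
    have "axis {i} a \<odot> axis {j} b + axis {j} b \<odot> axis {i} a
        = (a * b) *\<^sub>R (axis {i} 1 \<odot> axis {j} 1 + axis {j} 1 \<odot> axis {i} 1)"
      by (subst (1 2) ax[of i a], subst (1 2) ax[of j b])
        (simp add: linear_cmul[OF cl_mult_linear(1)] linear_cmul[OF cl_mult_linear(2)] scaleR_right_distrib mult.commute)
    then show ?thesis by (simp add: cl_generator_relation)
  qed
  have "2 *\<^sub>R (cl_vec v \<odot> cl_vec v) = (\<Sum>i\<in>UNIV. \<Sum>j\<in>UNIV. axis {i} (v $ i) \<odot> axis {j} (v $ j))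
      + (\<Sum>j\<in>UNIV. \<Sum>i\<in>UNIV. axis {i} (v $ i) \<odot> axis {j} (v $ j))"
    by (simp add: cl_vec_def linear_sum[OF cl_mult_linear(1)] linear_sum[OF cl_mult_linear(2)] scaleR_2)
      (subst sum.swap, rule refl)
  also have "\<dots> = (\<Sum>i\<in>UNIV. \<Sum>j\<in>UNIV. (if i = j then - 2 * (v $ i) * (v $ j) else 0) *\<^sub>R cl_one)"
    unfolding sum.distrib[symmetric] gen ..
  also have "\<dots> = (\<Sum>i\<in>UNIV. (- 2 * (v $ i) * (v $ i)) *\<^sub>R cl_one)"
    by (simp add: if_distrib[of "\<lambda>r. r *\<^sub>R _"] cong: if_cong)
  also have "\<dots> = (- 2 * (v \<bullet> v)) *\<^sub>R cl_one"
    by (simp add: inner_vec_def sum_distrib_left scaleR_left.sum sum_negf mult.assoc)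
  also have "\<dots> = 2 *\<^sub>R (- (v \<bullet> v) *\<^sub>R cl_one)" by simp
  finally show ?thesis by (simp only: scaleR_cancel_left) simp
qed

lemma card_ordered_pairs:
  fixes S :: "'n::{finite,linorder} set"
  shows "card {(i, j). i \<in> S \<and> j \<in> S \<and> j \<le> i} * 2 = card S * card S + card S"
proof -
  let ?L = "{(i, j). i \<in> S \<and> j \<in> S \<and> j \<le> i}" and ?U = "{(i, j). i \<in> S \<and> j \<in> S \<and> i \<le> j}"
  have "card ?U = card ?L"
    by (rule bij_betw_same_card[of prod.swap]) (auto simp: bij_betw_def inj_on_def image_def)
  moreover have "?L \<union> ?U = S \<times> S" by auto
  moreover have "?L \<inter> ?U = (\<lambda>i. (i, i)) ` S" by auto
  moreover have "card ((\<lambda>i. (i, i)) ` S) = card S" by (rule card_image) (simp add: inj_on_def)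
  ultimately show ?thesis
    using card_Un_Int[of ?L ?U] by (simp add: card_cartesian_product)
qed

text \<open>
  Moving e_i through the product of all n generators passes n - 1 generators that anticommute with it,
  an odd number.
\<close>

lemma cl_volume_anticommutes:
  fixes v :: "real ^ 'n::{finite,linorder}"
  assumes "even CARD('n)"
  shows "axis UNIV 1 \<odot> cl_vec v = - (cl_vec v \<odot> axis UNIV 1)"
proof -
  have sign: "cl_sign UNIV {i} = - cl_sign {i} UNIV" for i :: 'n
  proof -
    have "cl_sign UNIV {i} * cl_sign {i} UNIV = (\<Prod>j\<in>UNIV. (if i \<le> j then -1 else 1) * (if j \<le> i then -1 else (1::real)))"
      by (simp add: cl_sign_eq_prod prod.distrib)
    also have "\<dots> = (\<Prod>j\<in>UNIV. (if j = i then - 1 else 1) * (-1))"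
      by (intro prod.cong) (auto simp: linorder_not_le)
    also have "\<dots> = - 1" using assms by (simp only: prod.distrib prod_constant) simp
    finally have "cl_sign UNIV {i} * cl_sign {i} UNIV = - 1" .
    moreover have "cl_sign {i} UNIV * cl_sign {i} UNIV = 1"
      by (simp add: cl_sign_def flip: power_mult_distrib)
    ultimately show ?thesis by (metis mult.assoc mult.commute mult_1 mult_minus1)
  qed
  have "axis UNIV 1 \<odot> axis {i} a = - (axis {i} a \<odot> axis UNIV 1)" for i :: 'n and a
  proof -
    have "axis UNIV 1 \<odot> axis {i} a = axis (sym_diff UNIV {i}) (- (cl_sign {i} UNIV * a * 1))"
      by (simp add: cl_mult_axis sign)
    also have "sym_diff UNIV {i} = sym_diff {i} UNIV" by auto
    also have "axis \<dots> (- (cl_sign {i} UNIV * a * 1)) = - axis \<dots> (cl_sign {i} UNIV * a * 1)"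
      by (simp add: vec_eq_iff axis_def)
    finally show ?thesis by (simp only: cl_mult_axis)
  qed
  then show ?thesis
    by (simp add: cl_vec_def linear_sum[OF cl_mult_linear(1)] linear_sum[OF cl_mult_linear(2)] sum_negf)
qed

text \<open>
  The sign is (-1)^(n (n + 1) / 2), which is 1 when 4 divides n.
\<close>

lemma cl_volume_square:
  assumes "CARD('n::{finite,linorder}) mod 4 = 0"
  shows "axis UNIV 1 \<odot> axis UNIV 1 = (cl_one :: 'n clifford)"
proof -
  let ?k = "card {(i, j). i \<in> (UNIV::'n set) \<and> j \<in> (UNIV::'n set) \<and> j \<le> i}"
  obtain m where m: "CARD('n) = 4 * m" using assms by blast
  have "?k * 2 = 16 * m * m + 4 * m" using card_ordered_pairs[of "UNIV::'n set"] m by simp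
  then have "?k = 2 * (4 * m * m + m)" by simp
  then have "cl_sign (UNIV::'n set) UNIV = 1" by (simp only: cl_sign_def power_mult) simp
  then show ?thesis by (simp add: cl_mult_axis cl_one_def)
qed

definition clifford_action :: "('n::{finite,linorder} clifford \<Rightarrow> real ^ 's ^ 's) \<Rightarrow> real ^ 'n::{finite,linorder} \<Rightarrow> real ^ 's \<Rightarrow> real ^ 's" where
  "clifford_action \<rho> w \<phi> = \<rho> (cl_vec w) *v \<phi>"

lemma matrix_vector_mult_uminus: "(- A) *v x = - (A *v (x :: real ^ 'n))"
  by (simp add: matrix_vector_mult_def vec_eq_iff sum_negf)

lemma matrix_vector_mult_scaleR: "(a *\<^sub>R A) *v x = a *\<^sub>R (A *v (x :: real ^ 'n))"
  by (simp add: matrix_vector_mult_def vec_eq_iff sum_distrib_left mult.assoc)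

context
  fixes \<rho> :: "'n::{finite,linorder} clifford \<Rightarrow> real ^ 's ^ 's"
  assumes \<rho>: "spin_module \<rho>"
begin

lemma spin_module_linear: "linear \<rho>" and spin_module_one: "\<rho> cl_one = mat 1"
  and spin_module_mult: "\<rho> (x \<odot> y) = \<rho> x ** \<rho> y"
  and spin_module_skew: "transpose (\<rho> (cl_vec v)) = - \<rho> (cl_vec v)"
  using \<rho> by (auto simp: spin_module_def)

lemma spin_module_vec_square: "\<rho> (cl_vec v) ** \<rho> (cl_vec v) = - (v \<bullet> v) *\<^sub>R mat 1"
  by (metis spin_module_mult cl_vec_square linear_cmul[OF spin_module_linear] spin_module_one)

lemma spin_module_unit_orthogonal:
  assumes "norm v = 1"
  shows "orthogonal_matrix (\<rho> (cl_vec v))"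
proof -
  have "- \<rho> (cl_vec v) ** \<rho> (cl_vec v) = - (\<rho> (cl_vec v) ** \<rho> (cl_vec v))"
    by (simp add: matrix_matrix_mult_def vec_eq_iff sum_negf)
  then show ?thesis
    using assms by (simp add: orthogonal_matrix spin_module_skew spin_module_vec_square dot_square_norm)
qed

lemma spin_module_Spin_orthogonal: "g \<in> Spin \<Longrightarrow> orthogonal_matrix (\<rho> g)"
  by (induction rule: Spin.induct)
    (simp_all add: spin_module_one orthogonal_matrix_id spin_module_mult orthogonal_matrix_mul spin_module_unit_orthogonal)

text \<open>
  The matrix of the volume element is orthogonal as a product of orthogonal matrices.  As it also
  squares to the identity, it is symmetric.
\<close>

lemma spin_module_axis_orthogonal: "orthogonal_matrix (\<rho> (axis S 1))"
  using finite[of S]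
proof (induction S rule: finite_linorder_max_induct)
  case empty
  then show ?case by (simp add: spin_module_one[unfolded cl_one_def] orthogonal_matrix_id)
next
  case (insert j S)
  have "axis (insert j S) 1 = axis S 1 \<odot> (axis {j} 1 :: 'n clifford)"
    using cl_mult_axis_ordered insert by metis
  moreover have "orthogonal_matrix (\<rho> (axis {j} 1))"
    using spin_module_unit_orthogonal[of "axis j 1"] by (simp add: cl_vec_axis)
  ultimately show ?case using insert by (simp add: spin_module_mult orthogonal_matrix_mul)
qed

lemma spin_module_graded:
  assumes "CARD('n) mod 4 = 0"
  shows "graded_clifford_module (clifford_action \<rho>) (\<lambda>\<phi>. \<rho> (axis UNIV 1) *v \<phi>)"
proof (rule graded_clifford_module.intro)
  let ?w = "\<rho> (axis UNIV 1)"
  show "bilinear (clifford_action \<rho>)"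
    unfolding bilinear_def clifford_action_def
    by (auto intro!: linearI simp: linear_add[OF linear_cl_vec] linear_cmul[OF linear_cl_vec]
      linear_add[OF spin_module_linear] linear_cmul[OF spin_module_linear] matrix_vector_mult_add_rdistrib
      matrix_vector_right_distrib matrix_vector_mult_scaleR vec.scale)
  show "linear (\<lambda>\<phi>. ?w *v \<phi>)" by (rule matrix_vector_mul_linear)
  have ww: "?w ** ?w = mat 1"
    using cl_volume_square[OF assms] by (simp add: spin_module_one flip: spin_module_mult)
  have "transpose ?w = transpose ?w ** (?w ** ?w)" by (simp add: ww)
  also have "\<dots> = (transpose ?w ** ?w) ** ?w" by (simp only: matrix_mul_assoc)
  also have "\<dots> = ?w" using spin_module_axis_orthogonal[of UNIV] by (simp add: orthogonal_matrix)
  finally have tw: "transpose ?w = ?w" .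
  fix x \<phi> \<phi>'
  show "clifford_action \<rho> x \<phi> \<bullet> \<phi>' = - (\<phi> \<bullet> clifford_action \<rho> x \<phi>')"
    unfolding clifford_action_def
    by (metis dot_lmul_matrix spin_module_skew inner_minus_right matrix_vector_mult_uminus transpose_matrix_vector transpose_transpose)
  show "clifford_action \<rho> x (clifford_action \<rho> x \<phi>) = - (x \<bullet> x) *\<^sub>R \<phi>"
    by (simp add: clifford_action_def matrix_vector_mul_assoc spin_module_vec_square matrix_vector_mult_scaleR matrix_vector_mult_uminus)
  show "(?w *v \<phi>) \<bullet> \<phi>' = \<phi> \<bullet> (?w *v \<phi>')"
    by (metis dot_lmul_matrix transpose_matrix_vector tw)
  show "?w *v (?w *v \<phi>) = \<phi>" by (simp add: matrix_vector_mul_assoc ww)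
  have "?w ** \<rho> (cl_vec x) = - (\<rho> (cl_vec x) ** ?w)"
    using assms cl_volume_anticommutes[of x]
    by (metis spin_module_mult linear_neg[OF spin_module_linear] dvd_trans even_numeral mod_0_imp_dvd dvd_numeral_simp)
  then show "?w *v clifford_action \<rho> x \<phi> = - clifford_action \<rho> x (?w *v \<phi>)"
    by (simp add: clifford_action_def matrix_vector_mul_assoc matrix_vector_mult_uminus)
qed

end

section \<open>Orthonormal coordinates and the spin Lie algebra\<close>

text \<open>
  A vector orthogonal to the frame and to the normal would be one orthogonal vector too many.
\<close>

lemma orthonormal_frame_inner:
  fixes e :: "'n::finite \<Rightarrow> 'a::euclidean_space"
  assumes dim: "DIM('a) = CARD('n) + 1"
    and e: "\<And>i j. e i \<bullet> e j = (if i = j then 1 else 0)"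
    and \<nu>: "\<nu> \<bullet> \<nu> = 1" "\<And>i. e i \<bullet> \<nu> = 0"
  shows "x \<bullet> y = (\<Sum>i\<in>UNIV. (x \<bullet> e i) * (y \<bullet> e i)) + (x \<bullet> \<nu>) * (y \<bullet> \<nu>)"
proof -
  define r where "r = x - (\<Sum>i\<in>UNIV. (x \<bullet> e i) *\<^sub>R e i) - (x \<bullet> \<nu>) *\<^sub>R \<nu>"
  have r\<nu>: "r \<bullet> \<nu> = 0" by (simp add: r_def inner_diff_left inner_sum_left \<nu>)
  have "e i \<bullet> r = 0" for i
    by (simp add: r_def inner_diff_right inner_sum_right e \<nu> if_distrib inner_commute[of x] cong: if_cong)
  then have re: "r \<bullet> e i = 0" for i by (simp add: inner_commute)
  have "r = 0"
  proof (rule ccontr)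
    assume "r \<noteq> 0"
    let ?f = "\<lambda>k. case k of None \<Rightarrow> r | Some None \<Rightarrow> \<nu> | Some (Some i) \<Rightarrow> e i"
    have "card (UNIV :: 'n option option set) \<le> DIM('a)"
    proof (rule orthogonal_family_card_le[of _ ?f])
      show "?f k \<noteq> 0" for k
        using \<open>r \<noteq> 0\<close> \<nu>(1) e by (auto split: option.splits) (metis inner_zero_left zero_neq_one)
      show "?f k \<bullet> ?f l = 0" if "k \<noteq> l" for k l
        using that re r\<nu> \<nu> e by (auto split: option.splits simp: inner_commute)
    qed simp
    then show False using dim by (simp add: card_UNIV_option)
  qed
  then have "x = (\<Sum>i\<in>UNIV. (x \<bullet> e i) *\<^sub>R e i) + (x \<bullet> \<nu>) *\<^sub>R \<nu>"
    by (simp add: r_def algebra_simps)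
  then have "x \<bullet> y = ((\<Sum>i\<in>UNIV. (x \<bullet> e i) *\<^sub>R e i) + (x \<bullet> \<nu>) *\<^sub>R \<nu>) \<bullet> y" by simp
  then show ?thesis by (simp add: inner_add_left inner_sum_left inner_commute[of "e _" y] inner_commute[of \<nu> y])
qed

locale graded_clifford_module_coords = graded_clifford_module c \<omega>
  for c :: "real ^ 'n \<Rightarrow> 's::euclidean_space \<Rightarrow> 's" and \<omega>
begin

abbreviation E :: "'n \<Rightarrow> 's \<Rightarrow> 's" where "E i \<equiv> c (axis i 1)"

text \<open>
  The action of the Lie algebra of the spin group, with the factor 1/4 of the lift from the
  orthogonal Lie algebra.
\<close>

definition bivector :: "real ^ 'n ^ 'n \<Rightarrow> 's \<Rightarrow> 's" where
  "bivector a \<phi> = (1 / 4) *\<^sub>R (\<Sum>i\<in>UNIV. \<Sum>j\<in>UNIV. (a $ i $ j) *\<^sub>R E i (E j \<phi>))"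

lemma c_lin: "linear (\<lambda>w. c w \<phi>)" "linear (c w)"
  using bilin by (auto simp: bilinear_def)

lemma c_coords: "c w \<phi> = (\<Sum>i\<in>UNIV. (w $ i) *\<^sub>R E i \<phi>)"
proof -
  have "w = (\<Sum>i\<in>UNIV. (w $ i) *\<^sub>R axis i 1)" by (simp add: vec_eq_iff axis_def if_distrib cong: if_cong)
  then have "c w \<phi> = c (\<Sum>i\<in>UNIV. (w $ i) *\<^sub>R axis i 1) \<phi>" by simp
  also have "\<dots> = (\<Sum>i\<in>UNIV. (w $ i) *\<^sub>R E i \<phi>)"
    by (simp only: linear_sum[OF c_lin(1)] linear_cmul[OF c_lin(1)])
  finally show ?thesis .
qed

lemma bilinear_bivector: "bilinear bivector"
  unfolding bilinear_def bivector_def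
  by (auto intro!: linearI simp: scaleR_left_distrib sum.distrib c_simps scaleR_right_distrib scaleR_sum_right add_divide_distrib mult.commute mult.left_commute)

lemmas bivector_simps = bilinear_ladd[OF bilinear_bivector] bilinear_radd[OF bilinear_bivector] bilinear_lmul[OF bilinear_bivector]
  bilinear_rmul[OF bilinear_bivector] bilinear_lneg[OF bilinear_bivector] bilinear_rneg[OF bilinear_bivector]
  bilinear_lsub[OF bilinear_bivector] bilinear_rsub[OF bilinear_bivector]

lemma bivector_rank_one: "bivector (\<chi> i j. x $ i * y $ j) \<phi> = (1 / 4) *\<^sub>R c x (c y \<phi>)"
proof -
  have "c x (c y \<phi>) = (\<Sum>i\<in>UNIV. (x $ i) *\<^sub>R E i (\<Sum>j\<in>UNIV. (y $ j) *\<^sub>R E j \<phi>))"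
    by (simp only: c_coords[of x] c_coords[of y])
  also have "\<dots> = (\<Sum>i\<in>UNIV. \<Sum>j\<in>UNIV. (x $ i * y $ j) *\<^sub>R E i (E j \<phi>))"
    by (simp add: linear_sum[OF c_lin(2)] c_simps scaleR_sum_right)
  finally show ?thesis by (simp add: bivector_def)
qed

lemma bivector_commute_vector:
  assumes a: "\<And>i j. a $ i $ j = - a $ j $ i"
  shows "bivector a (c w \<phi>) = c w (bivector a \<phi>) - c (a *v w) \<phi>"
proof -
  have EE: "E i (E j (c w \<phi>)) = c w (E i (E j \<phi>)) + ((2 * w $ i) *\<^sub>R E j \<phi> - (2 * w $ j) *\<^sub>R E i \<phi>)" for i j
  proof -
    have 1: "E i (c w \<phi>) = - c w (E i \<phi>) - (2 * w $ i) *\<^sub>R \<phi>" for i \<phi>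
      using clifford_relation[of "axis i 1" w \<phi>] by (simp add: inner_axis' algebra_simps eq_neg_iff_add_eq_0)
    show ?thesis by (simp add: 1 c_simps algebra_simps)
  qed
  have 2: "(\<Sum>i\<in>UNIV. \<Sum>j\<in>UNIV. (a $ i $ j) *\<^sub>R ((w $ j) *\<^sub>R E i \<phi>)) = c (a *v w) \<phi>"
    by (subst c_coords) (simp add: matrix_vector_mult_def scaleR_sum_left)
  have "(\<Sum>i\<in>UNIV. \<Sum>j\<in>UNIV. (a $ i $ j) *\<^sub>R ((w $ i) *\<^sub>R E j \<phi>)) =
        (\<Sum>i\<in>UNIV. \<Sum>j\<in>UNIV. - ((a $ i $ j) *\<^sub>R ((w $ j) *\<^sub>R E i \<phi>)))"
    by (subst sum.swap, intro sum.cong refl, subst a) simp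
  then have 3: "(\<Sum>i\<in>UNIV. \<Sum>j\<in>UNIV. (a $ i $ j) *\<^sub>R ((w $ i) *\<^sub>R E j \<phi>)) = - c (a *v w) \<phi>"
    by (simp only: sum_negf 2)
  have "bivector a (c w \<phi>) = (1 / 4) *\<^sub>R (\<Sum>i\<in>UNIV. \<Sum>j\<in>UNIV. (a $ i $ j) *\<^sub>R c w (E i (E j \<phi>))
      + 2 *\<^sub>R ((a $ i $ j) *\<^sub>R ((w $ i) *\<^sub>R E j \<phi>)) - 2 *\<^sub>R ((a $ i $ j) *\<^sub>R ((w $ j) *\<^sub>R E i \<phi>)))"
    unfolding bivector_def EE by (simp add: algebra_simps)
  also have "\<dots> = (1 / 4) *\<^sub>R (\<Sum>i\<in>UNIV. \<Sum>j\<in>UNIV. (a $ i $ j) *\<^sub>R c w (E i (E j \<phi>)))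
     + (1 / 4) *\<^sub>R (2 *\<^sub>R (- c (a *v w) \<phi>)) - (1 / 4) *\<^sub>R (2 *\<^sub>R c (a *v w) \<phi>)"
    unfolding sum_subtractf sum.distrib scaleR_sum_right[symmetric] 2 3
    by (simp add: algebra_simps)
  also have "(1 / 4) *\<^sub>R (\<Sum>i\<in>UNIV. \<Sum>j\<in>UNIV. (a $ i $ j) *\<^sub>R c w (E i (E j \<phi>))) = c w (bivector a \<phi>)"
    by (simp add: bivector_def linear_sum[OF c_lin(2)] c_simps)
  finally show ?thesis by (simp add: algebra_simps flip: scaleR_left_distrib)
qed

text \<open>
  With this sign convention the lift reverses brackets.  This is what cancels the quadratic terms of
  the connection against those in the structure equation of the frame below.
\<close>

lemma bivector_commutator:
  assumes a: "\<And>i j. a $ i $ j = - a $ j $ i"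
  shows "bivector a (bivector b \<phi>) - bivector b (bivector a \<phi>) = - bivector (a ** b - b ** a) \<phi>"
proof -
  have lin: "linear (bivector a)" using bilinear_bivector by (simp add: bilinear_def)
  have ax: "a *v axis k 1 = (\<chi> i. a $ i $ k)" for k
    by (simp add: matrix_vector_mult_def axis_def vec_eq_iff if_distrib cong: if_cong)
  have EE: "bivector a (E k (E l \<phi>)) = E k (E l (bivector a \<phi>)) - E k (c (\<chi> i. a $ i $ l) \<phi>) - c (\<chi> i. a $ i $ k) (E l \<phi>)" for k l
    by (simp add: bivector_commute_vector[OF a] ax c_simps)
  have 1: "(\<Sum>k\<in>UNIV. \<Sum>l\<in>UNIV. (b $ k $ l) *\<^sub>R c (\<chi> i. a $ i $ k) (E l \<phi>)) = 4 *\<^sub>R bivector (a ** b) \<phi>"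
  proof -
    have "(\<Sum>k\<in>UNIV. \<Sum>l\<in>UNIV. (b $ k $ l) *\<^sub>R c (\<chi> i. a $ i $ k) (E l \<phi>))
        = (\<Sum>k\<in>UNIV. \<Sum>l\<in>UNIV. \<Sum>i\<in>UNIV. (a $ i $ k * b $ k $ l) *\<^sub>R E i (E l \<phi>))"
      by (simp add: c_coords[of "\<chi> i. _ i"] scaleR_sum_right mult.commute)
    also have "\<dots> = (\<Sum>i\<in>UNIV. \<Sum>l\<in>UNIV. \<Sum>k\<in>UNIV. (a $ i $ k * b $ k $ l) *\<^sub>R E i (E l \<phi>))"
      by (subst (2) sum.swap, subst sum.swap, subst (2) sum.swap, rule refl)
    finally show ?thesis by (simp add: bivector_def matrix_matrix_mult_def scaleR_sum_left)
  qed
  have 2: "(\<Sum>k\<in>UNIV. \<Sum>l\<in>UNIV. (b $ k $ l) *\<^sub>R E k (c (\<chi> i. a $ i $ l) \<phi>)) = - (4 *\<^sub>R bivector (b ** a) \<phi>)"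
  proof -
    have "(\<Sum>k\<in>UNIV. \<Sum>l\<in>UNIV. (b $ k $ l) *\<^sub>R E k (c (\<chi> i. a $ i $ l) \<phi>))
        = (\<Sum>k\<in>UNIV. \<Sum>l\<in>UNIV. \<Sum>i\<in>UNIV. (b $ k $ l * a $ i $ l) *\<^sub>R E k (E i \<phi>))"
      by (simp add: c_coords[of "\<chi> i. _ i"] scaleR_sum_right linear_sum[OF c_lin(2)] c_simps)
    also have "\<dots> = (\<Sum>k\<in>UNIV. \<Sum>l\<in>UNIV. \<Sum>i\<in>UNIV. - ((b $ k $ l * a $ l $ i) *\<^sub>R E k (E i \<phi>)))"
    proof (intro sum.cong refl)
      show "(b $ k $ l * a $ i $ l) *\<^sub>R y = - ((b $ k $ l * a $ l $ i) *\<^sub>R y)" for k l i and y :: 's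
        using a[of i l] by simp
    qed
    also have "\<dots> = (\<Sum>k\<in>UNIV. \<Sum>i\<in>UNIV. \<Sum>l\<in>UNIV. - ((b $ k $ l * a $ l $ i) *\<^sub>R E k (E i \<phi>)))"
      by (rule sum.cong[OF refl], rule sum.swap)
    finally show ?thesis by (simp add: bivector_def matrix_matrix_mult_def scaleR_sum_left sum_negf)
  qed
  have "bivector a (bivector b \<phi>) = (1 / 4) *\<^sub>R (\<Sum>k\<in>UNIV. \<Sum>l\<in>UNIV. (b $ k $ l) *\<^sub>R bivector a (E k (E l \<phi>)))"
    unfolding bivector_def[of b] by (simp add: linear_sum[OF lin] linear_cmul[OF lin])
  also have "\<dots> = bivector b (bivector a \<phi>) - (1 / 4) *\<^sub>R (- (4 *\<^sub>R bivector (b ** a) \<phi>))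
      - (1 / 4) *\<^sub>R (4 *\<^sub>R bivector (a ** b) \<phi>)"
    unfolding EE scaleR_diff_right sum_subtractf 1 2 bivector_def[of b "bivector a \<phi>"] ..
  finally show ?thesis by (simp add: bivector_simps)
qed

text \<open>
  The equation eq says that the two mixed second derivatives of \<psi> agree, where \<psi> has derivative
  c \<alpha> \<psi> - bivector \<Gamma> \<psi> in either direction and \<beta>, M are the derivatives of the coefficients.
  Commutators of bivectors with vectors are vectors, so apart from single vectors only the products
  of the two \<alpha> and the curvature of the frame survive.
\<close>

lemma curvature_algebra:
  assumes skew1: "\<And>i j. \<Gamma>1 $ i $ j = - \<Gamma>1 $ j $ i" and skew2: "\<And>i j. \<Gamma>2 $ i $ j = - \<Gamma>2 $ j $ i"
    and eq: "c \<beta>1 \<psi> + c \<alpha>1 (c \<alpha>2 \<psi> - bivector \<Gamma>2 \<psi>) - bivector M1 \<psi> - bivector \<Gamma>1 (c \<alpha>2 \<psi> - bivector \<Gamma>2 \<psi>)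
      = c \<beta>2 \<psi> + c \<alpha>2 (c \<alpha>1 \<psi> - bivector \<Gamma>1 \<psi>) - bivector M2 \<psi> - bivector \<Gamma>2 (c \<alpha>1 \<psi> - bivector \<Gamma>1 \<psi>)"
    and M: "M1 - M2 = (\<chi> i j. x $ i * y $ j) - (\<chi> i j. y $ i * x $ j) - (\<Gamma>1 ** \<Gamma>2 - \<Gamma>2 ** \<Gamma>1)"
  shows "\<exists>b. c \<alpha>1 (c \<alpha>2 \<psi>) - c \<alpha>2 (c \<alpha>1 \<psi>) - (1 / 4) *\<^sub>R (c x (c y \<psi>) - c y (c x \<psi>)) = c b \<psi>"
proof
  have "bivector M1 \<psi> - bivector M2 \<psi> = bivector (M1 - M2) \<psi>" by (simp add: bivector_simps)
  also have "\<dots> = (1 / 4) *\<^sub>R (c x (c y \<psi>) - c y (c x \<psi>)) - bivector (\<Gamma>1 ** \<Gamma>2 - \<Gamma>2 ** \<Gamma>1) \<psi>"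
    unfolding M by (simp add: bivector_simps bivector_rank_one scaleR_diff_right)
  also have "bivector (\<Gamma>1 ** \<Gamma>2 - \<Gamma>2 ** \<Gamma>1) \<psi> = bivector \<Gamma>2 (bivector \<Gamma>1 \<psi>) - bivector \<Gamma>1 (bivector \<Gamma>2 \<psi>)"
    using bivector_commutator[OF skew1, of \<Gamma>2 \<psi>] by (metis minus_diff_eq minus_minus)
  finally have M1: "bivector M1 \<psi> = bivector M2 \<psi> + (1 / 4) *\<^sub>R (c x (c y \<psi>) - c y (c x \<psi>))
      + (bivector \<Gamma>1 (bivector \<Gamma>2 \<psi>) - bivector \<Gamma>2 (bivector \<Gamma>1 \<psi>))"
    by (simp add: algebra_simps)
  show "c \<alpha>1 (c \<alpha>2 \<psi>) - c \<alpha>2 (c \<alpha>1 \<psi>) - (1 / 4) *\<^sub>R (c x (c y \<psi>) - c y (c x \<psi>))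
      = c (\<beta>2 - \<beta>1 - \<Gamma>1 *v \<alpha>2 + \<Gamma>2 *v \<alpha>1) \<psi>"
    using eq
    unfolding M1 c_simps bivector_simps bivector_commute_vector[OF skew1] bivector_commute_vector[OF skew2]
    by (simp add: algebra_simps)
qed

end

section \<open>Spinors in a moving frame\<close>

lemma has_derivative_vec_lambda:
  fixes f :: "'i::finite \<Rightarrow> 'a::real_normed_vector \<Rightarrow> 'b::euclidean_space"
  assumes "\<And>i. (f i has_derivative f' i) (at x within S)"
  shows "((\<lambda>x. \<chi> i. f i x) has_derivative (\<lambda>h. \<chi> i. f' i h)) (at x within S)"
  unfolding has_derivative_componentwise_within[of "\<lambda>x. \<chi> i. f i x"]
  using assms by (auto simp: Basis_vec_def inner_axis intro: has_derivative_inner_left)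

lemma Ck_on_2_has_derivative:
  assumes "open W" "x \<in> W" "Ck_on 2 W f"
  shows "(f has_derivative frechet_derivative f (at x)) (at x)"
    and "((\<lambda>y. frechet_derivative f (at y) v) has_derivative
      frechet_derivative (\<lambda>y. frechet_derivative f (at y) v) (at x)) (at x)"
  using assms
  by (simp_all add: numeral_2_eq_2 differentiable_on_eq_differentiable_at[OF assms(1)] flip: frechet_derivative_works)

lemma has_derivative_constant_zero:
  assumes "open W" "x \<in> W" "\<And>y. y \<in> W \<Longrightarrow> f y = k" "(f has_derivative f') (at x)"
  shows "f' h = 0"
proof -
  have "(f has_derivative (\<lambda>h. 0)) (at x)"
    using has_derivative_transform_within_open[OF has_derivative_const assms(1,2)] assms(3) by metis
  then show ?thesis using has_derivative_unique assms(4) by blast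
qed

definition frame_connection ::
  "('n::finite \<Rightarrow> 'a::euclidean_space \<Rightarrow> 'a) \<Rightarrow> 'a \<Rightarrow> 'a \<Rightarrow> real ^ 'n ^ 'n" where
  "frame_connection e y v = (\<chi> i j. frechet_derivative (e i) (at y) v \<bullet> e j y)"

text \<open>
  An orthonormal frame of the orthogonal complement of a unit normal field N on an open set of the
  ambient space.  It will be used for frames of the sphere, extended constantly along rays.
\<close>

locale moving_frame =
  fixes W :: "'a::euclidean_space set" and e :: "'n::finite \<Rightarrow> 'a \<Rightarrow> 'a" and N :: "'a \<Rightarrow> 'a" and N' x
  assumes W: "open W" "x \<in> W"
    and dim: "DIM('a) = CARD('n) + 1"
    and smooth: "\<And>i. Ck_on 2 W (e i)"
    and normal_derivative: "(N has_derivative N') (at x)"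
    and orthonormal: "\<And>y i j. y \<in> W \<Longrightarrow> e i y \<bullet> e j y = (if i = j then 1 else 0)"
    and normal: "\<And>y i. y \<in> W \<Longrightarrow> e i y \<bullet> N y = 0" "\<And>y. y \<in> W \<Longrightarrow> N y \<bullet> N y = 1"
begin

abbreviation "\<Gamma> \<equiv> frame_connection e"

definition "\<Gamma>' v w = (\<chi> i j. frechet_derivative (\<lambda>y. frechet_derivative (e i) (at y) v) (at x) w \<bullet> e j x
    + frechet_derivative (e i) (at x) v \<bullet> frechet_derivative (e j) (at x) w)"

lemma connection_derivative: "((\<lambda>y. \<Gamma> y v) has_derivative \<Gamma>' v) (at x)"
  unfolding frame_connection_def \<Gamma>'_def
  by (intro has_derivative_vec_lambda)
     (rule has_derivative_eq_rhs[OF has_derivative_inner[OF Ck_on_2_has_derivative(2)[OF W smooth] Ck_on_2_has_derivative(1)[OF W smooth]]],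
      simp add: add.commute)

lemma connection_skew: "\<Gamma> x v $ i $ j = - \<Gamma> x v $ j $ i"
proof -
  note D = Ck_on_2_has_derivative(1)[OF W smooth]
  have "e i x \<bullet> frechet_derivative (e j) (at x) v + frechet_derivative (e i) (at x) v \<bullet> e j x = 0"
    by (rule has_derivative_constant_zero[OF W orthonormal[of _ i j] has_derivative_inner[OF D D]])
  then show ?thesis by (simp add: frame_connection_def inner_commute)
qed

lemma connection_normal: "frechet_derivative (e i) (at x) v \<bullet> N x = - (N' v \<bullet> e i x)"
proof -
  note D = Ck_on_2_has_derivative(1)[OF W smooth]
  have "e i x \<bullet> N' v + frechet_derivative (e i) (at x) v \<bullet> N x = 0"
    by (rule has_derivative_constant_zero[OF W normal(1)[of _ i] has_derivative_inner[OF D normal_derivative]])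
  then show ?thesis by (simp add: inner_commute)
qed

text \<open>
  The ambient connection is flat, and the derivative of N is all of it that the connection matrix
  of the frame misses; so the curvature of the frame is given by products of components of N'.
\<close>

lemma connection_structure_equation:
  "\<Gamma>' v u - \<Gamma>' u v = (\<chi> i j. (\<chi> k. N' v \<bullet> e k x) $ i * (\<chi> k. N' u \<bullet> e k x) $ j)
     - (\<chi> i j. (\<chi> k. N' u \<bullet> e k x) $ i * (\<chi> k. N' v \<bullet> e k x) $ j) - (\<Gamma> x v ** \<Gamma> x u - \<Gamma> x u ** \<Gamma> x v)"
proof -
  have parseval: "frechet_derivative (e i) (at x) v \<bullet> frechet_derivative (e j) (at x) u
      = - (\<Gamma> x v ** \<Gamma> x u) $ i $ j + (N' v \<bullet> e i x) * (N' u \<bullet> e j x)" for i j u v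
  proof -
    have "frechet_derivative (e i) (at x) v \<bullet> frechet_derivative (e j) (at x) u
      = (\<Sum>k\<in>UNIV. \<Gamma> x v $ i $ k * \<Gamma> x u $ j $ k) + (N' v \<bullet> e i x) * (N' u \<bullet> e j x)"
      using orthonormal_frame_inner[OF dim orthonormal[OF W(2)] normal(2)[OF W(2)] normal(1)[OF W(2)],
        of "frechet_derivative (e i) (at x) v" "frechet_derivative (e j) (at x) u"]
      by (simp add: connection_normal) (simp add: frame_connection_def)
    also have "(\<Sum>k\<in>UNIV. \<Gamma> x v $ i $ k * \<Gamma> x u $ j $ k) = (\<Sum>k\<in>UNIV. - (\<Gamma> x v $ i $ k * \<Gamma> x u $ k $ j))"
      by (intro sum.cong refl, subst connection_skew[of u j]) simp
    finally show ?thesis by (simp add: matrix_matrix_mult_def sum_negf)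
  qed
  show ?thesis
    by (simp add: vec_eq_iff \<Gamma>'_def parseval Ck_on_2_mixed_derivatives_commute[OF W smooth, of _ v u])
qed

end

locale moving_frame_spinor = moving_frame W e N N' x + graded_clifford_module_coords c \<omega>
  for W :: "'a::euclidean_space set" and e :: "'n::finite \<Rightarrow> 'a \<Rightarrow> 'a" and N N' x
    and c :: "real ^ 'n \<Rightarrow> 's::euclidean_space \<Rightarrow> 's" and \<omega> +
  fixes \<psi> :: "'a \<Rightarrow> 's" and \<alpha> :: "'a \<Rightarrow> 'a \<Rightarrow> real ^ 'n"
  assumes spinor_smooth: "Ck_on 2 W \<psi>"
    and endo_differentiable: "\<And>v. (\<lambda>y. \<alpha> y v) differentiable (at x)"
    and spinor_equation: "\<And>y v. y \<in> W \<Longrightarrow>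
      frechet_derivative \<psi> (at y) v = c (\<alpha> y v) (\<psi> y) - bivector (frame_connection e y v) (\<psi> y)"
begin

text \<open>
  Equality of the mixed second derivatives of \<psi> at x, with the derivatives of \<psi> replaced by the
  right-hand side of its equation.
\<close>

lemma curvature_identity:
  "\<exists>b. c (\<alpha> x v) (c (\<alpha> x u) (\<psi> x)) - c (\<alpha> x u) (c (\<alpha> x v) (\<psi> x))
     - (1 / 4) *\<^sub>R (c (\<chi> k. N' v \<bullet> e k x) (c (\<chi> k. N' u \<bullet> e k x) (\<psi> x))
        - c (\<chi> k. N' u \<bullet> e k x) (c (\<chi> k. N' v \<bullet> e k x) (\<psi> x))) = c b (\<psi> x)"
proof (rule curvature_algebra[OF connection_skew connection_skew _ connection_structure_equation])
  have bb: "bounded_bilinear c" "bounded_bilinear bivector"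
    using bilin bilinear_bivector by (simp_all add: bilinear_conv_bounded_bilinear)
  define \<beta> where "\<beta> w = frechet_derivative (\<lambda>y. \<alpha> y w) (at x)" for w
  have \<beta>: "((\<lambda>y. \<alpha> y w) has_derivative \<beta> w) (at x)" for w
    using endo_differentiable unfolding \<beta>_def by (simp add: frechet_derivative_works)
  let ?D = "\<lambda>w. frechet_derivative \<psi> (at x) w"
  have second: "frechet_derivative (\<lambda>y. frechet_derivative \<psi> (at y) w) (at x) h
      = c (\<alpha> x w) (?D h) + c (\<beta> w h) (\<psi> x) - (bivector (\<Gamma> x w) (?D h) + bivector (\<Gamma>' w h) (\<psi> x))" for w h
  proof -
    have "((\<lambda>y. c (\<alpha> y w) (\<psi> y) - bivector (\<Gamma> y w) (\<psi> y)) has_derivative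
      (\<lambda>h. c (\<alpha> x w) (?D h) + c (\<beta> w h) (\<psi> x) - (bivector (\<Gamma> x w) (?D h) + bivector (\<Gamma>' w h) (\<psi> x)))) (at x)"
      by (intro has_derivative_diff bounded_bilinear.FDERIV[OF bb(1)] bounded_bilinear.FDERIV[OF bb(2)]
        \<beta> connection_derivative Ck_on_2_has_derivative(1)[OF W spinor_smooth])
    then have "((\<lambda>y. frechet_derivative \<psi> (at y) w) has_derivative
      (\<lambda>h. c (\<alpha> x w) (?D h) + c (\<beta> w h) (\<psi> x) - (bivector (\<Gamma> x w) (?D h) + bivector (\<Gamma>' w h) (\<psi> x)))) (at x)"
      by (rule has_derivative_transform_within_open[OF _ W]) (simp add: spinor_equation)
    from fun_cong[OF frechet_derivative_at[OF this], of h] show ?thesis by (simp only:)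
  qed
  have D: "?D w = c (\<alpha> x w) (\<psi> x) - bivector (\<Gamma> x w) (\<psi> x)" for w by (rule spinor_equation[OF W(2)])
  show "c (\<beta> v u) (\<psi> x) + c (\<alpha> x v) (c (\<alpha> x u) (\<psi> x) - bivector (\<Gamma> x u) (\<psi> x)) - bivector (\<Gamma>' v u) (\<psi> x)
        - bivector (\<Gamma> x v) (c (\<alpha> x u) (\<psi> x) - bivector (\<Gamma> x u) (\<psi> x))
      = c (\<beta> u v) (\<psi> x) + c (\<alpha> x u) (c (\<alpha> x v) (\<psi> x) - bivector (\<Gamma> x v) (\<psi> x)) - bivector (\<Gamma>' u v) (\<psi> x)
        - bivector (\<Gamma> x u) (c (\<alpha> x v) (\<psi> x) - bivector (\<Gamma> x v) (\<psi> x))"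
    using Ck_on_2_mixed_derivatives_commute[OF W spinor_smooth, of v u]
    unfolding second D by (simp add: algebra_simps)
qed

end

context graded_clifford_module_coords
begin

text \<open>
  Because of these rules the connection drops out of the derivatives of |\<psi>|^2 and of
  \<psi> \<bullet> \<omega> \<psi>.
\<close>

lemma bivector_skew_vol:
  assumes "\<And>i j. a $ i $ j = - a $ j $ i"
  shows "bivector a \<phi> \<bullet> \<phi>' = - (\<phi> \<bullet> bivector a \<phi>')" "\<omega> (bivector a \<phi>) = bivector a (\<omega> \<phi>)"
proof -
  have "(\<Sum>i\<in>UNIV. \<Sum>j\<in>UNIV. a $ i $ j * (E i (E j \<phi>) \<bullet> \<phi>')) = (\<Sum>i\<in>UNIV. \<Sum>j\<in>UNIV. - (a $ i $ j * (\<phi> \<bullet> E i (E j \<phi>'))))"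
    by (subst sum.swap, intro sum.cong refl, subst assms) (simp add: skew)
  then show "bivector a \<phi> \<bullet> \<phi>' = - (\<phi> \<bullet> bivector a \<phi>')"
    by (simp add: bivector_def inner_sum_left inner_sum_right sum_negf)
  show "\<omega> (bivector a \<phi>) = bivector a (\<omega> \<phi>)"
    by (simp add: bivector_def vol_simps linear_sum[OF linear_vol] vol_anticommute c_simps)
qed

end

context moving_frame_spinor
begin

lemma norm_derivative_zero: "((\<lambda>y. \<psi> y \<bullet> \<psi> y) has_derivative (\<lambda>h. 0)) (at x)"
proof -
  note D = Ck_on_2_has_derivative(1)[OF W spinor_smooth]
  have "\<psi> x \<bullet> frechet_derivative \<psi> (at x) h + frechet_derivative \<psi> (at x) h \<bullet> \<psi> x = 0" for h
    using c_self_orthogonal bivector_skew_vol(1)[OF connection_skew, of h "\<psi> x" "\<psi> x"]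
    by (simp add: spinor_equation[OF W(2)] inner_diff inner_commute)
  with has_derivative_inner[OF D D] show ?thesis by simp
qed

lemma vol_derivative:
  "((\<lambda>y. \<psi> y \<bullet> \<omega> (\<psi> y)) has_derivative (\<lambda>h. 2 * (c (\<alpha> x h) (\<psi> x) \<bullet> \<omega> (\<psi> x)))) (at x)"
proof -
  note D = Ck_on_2_has_derivative(1)[OF W spinor_smooth]
  have D\<omega>: "((\<lambda>y. \<omega> (\<psi> y)) has_derivative (\<lambda>h. \<omega> (frechet_derivative \<psi> (at x) h))) (at x)"
    by (rule bounded_linear.has_derivative[OF _ D]) (use linear_vol in \<open>simp add: linear_conv_bounded_linear\<close>)
  have "\<psi> x \<bullet> \<omega> (frechet_derivative \<psi> (at x) h) + frechet_derivative \<psi> (at x) h \<bullet> \<omega> (\<psi> x)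
      = 2 * (c (\<alpha> x h) (\<psi> x) \<bullet> \<omega> (\<psi> x))" for h
  proof -
    have "\<psi> x \<bullet> \<omega> (bivector (\<Gamma> x h) (\<psi> x)) = - (bivector (\<Gamma> x h) (\<psi> x) \<bullet> \<omega> (\<psi> x))"
      by (simp add: bivector_skew_vol[OF connection_skew])
    moreover have "\<psi> x \<bullet> \<omega> (c (\<alpha> x h) (\<psi> x)) = c (\<alpha> x h) (\<psi> x) \<bullet> \<omega> (\<psi> x)"
      by (metis vol_sym inner_commute)
    ultimately show ?thesis by (simp add: spinor_equation[OF W(2)] inner_diff vol_simps)
  qed
  with has_derivative_inner[OF D D\<omega>] show ?thesis by simp
qed

end

section \<open>Generalized Killing spinors on the sphere\<close>

definition cone_over :: "'a::euclidean_space set \<Rightarrow> 'a set" where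
  "cone_over U = {x. x \<noteq> 0 \<and> x /\<^sub>R norm x \<in> U}"

lemma cone_over_sgn: "cone_over U = {x. x \<noteq> 0 \<and> sgn x \<in> U}"
  by (simp add: cone_over_def sgn_div_norm)

lemma cone_over_unit_sphere: "cone_over unit_sphere = - {0}"
  by (auto simp: cone_over_sgn norm_sgn)

lemma smooth_on_sphere_iff: "smooth_on_sphere U f \<longleftrightarrow> (\<forall>k. Ck_on k (cone_over U) (radial_ext f))"
  by (simp add: smooth_on_sphere_def cone_over_def)

lemma radial_ext_sgn: "radial_ext f x = f (sgn x)"
  by (simp add: radial_ext_def sgn_div_norm)

lemma sgn_sgn_vector: "sgn (sgn x) = sgn x" for x :: "'a::real_normed_vector"
  by (cases "x = 0") (simp_all add: sgn_div_norm)

lemma sgn_in_sphere: "x \<noteq> 0 \<Longrightarrow> sgn x \<in> unit_sphere" for x :: "'a::euclidean_space"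
  by (simp add: norm_sgn)

lemma open_cone_over:
  assumes "openin (top_of_set unit_sphere) U"
  shows "open (cone_over U)"
proof -
  obtain T where T: "open T" "U = unit_sphere \<inter> T" using assms by (auto simp: openin_open)
  have "continuous_on (- {0}) (sgn :: 'a \<Rightarrow> 'a)"
    by (auto simp: sgn_div_norm[abs_def] intro!: continuous_intros)
  then have "open (- {0} \<inter> sgn -` T)"
    using T by (intro continuous_open_preimage) auto
  moreover have "cone_over U = - {0} \<inter> sgn -` T"
    by (auto simp: cone_over_sgn T norm_sgn)
  ultimately show ?thesis by simp
qed

text \<open>
  The derivative of the projection sgn to the sphere along rays: orthogonal projection to the tangent
  space, divided by the distance from the origin.
\<close>

definition sgn_deriv :: "'a::euclidean_space \<Rightarrow> 'a \<Rightarrow> 'a" where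
  "sgn_deriv x v = (v - (v \<bullet> sgn x) *\<^sub>R sgn x) /\<^sub>R norm x"

lemma has_derivative_sgn:
  fixes x :: "'a::euclidean_space"
  assumes "x \<noteq> 0"
  shows "(sgn has_derivative sgn_deriv x) (at x)"
proof -
  have "((\<lambda>y. inverse (norm y) *\<^sub>R y) has_derivative sgn_deriv x) (at x)"
    by (rule derivative_eq_intros has_derivative_norm refl assms | simp add: assms)+
       (auto simp: fun_eq_iff sgn_deriv_def sgn_div_norm algebra_simps assms)
  then show ?thesis by (simp add: sgn_div_norm[abs_def])
qed

lemma sgn_deriv_tangent: "x \<noteq> 0 \<Longrightarrow> sgn_deriv x v \<in> tangent_space (sgn x)"
  by (simp add: sgn_deriv_def inner_diff_left dot_square_norm norm_sgn)

lemma sgn_deriv_of_tangent: "x \<noteq> 0 \<Longrightarrow> X \<in> tangent_space (sgn x) \<Longrightarrow> sgn_deriv x (norm x *\<^sub>R X) = X"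
  by (simp add: sgn_deriv_def)

text \<open>
  The extension is invariant under sgn, so its derivative at any point of the ray is determined by
  the derivative on the sphere.
\<close>

lemma frechet_derivative_radial_ext:
  fixes f :: "'a::euclidean_space \<Rightarrow> 'b::euclidean_space"
  assumes x: "x \<noteq> 0" and d: "radial_ext f differentiable (at (sgn x))"
  shows "frechet_derivative (radial_ext f) (at x) v = sphere_deriv f (sgn x) (sgn_deriv x v)"
proof -
  have "((\<lambda>y. radial_ext f (sgn y)) has_derivative
      (\<lambda>v. frechet_derivative (radial_ext f) (at (sgn x)) (sgn_deriv x v))) (at x)"
    by (rule has_derivative_compose[OF has_derivative_sgn[OF x]]) (use d in \<open>simp add: frechet_derivative_works\<close>)
  moreover have "(\<lambda>y. radial_ext f (sgn y)) = radial_ext f"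
    by (simp add: radial_ext_sgn fun_eq_iff sgn_sgn_vector)
  ultimately show ?thesis
    unfolding sphere_deriv_def using frechet_derivative_at by metis
qed

text \<open>
  Besides n = 8 with rank 16, the dimensions allow n = 4 with rank 8.
\<close>

locale generalized_killing =
  fixes \<rho> :: "'n::{finite,linorder} clifford \<Rightarrow> real ^ 's ^ 's"
    and U :: "'c \<Rightarrow> (real ^ 'm) set"
    and e :: "'c \<Rightarrow> 'n \<Rightarrow> real ^ 'm \<Rightarrow> real ^ 'm"
    and s :: "'c \<Rightarrow> 'c \<Rightarrow> real ^ 'm \<Rightarrow> 'n clifford"
    and A :: "real ^ 'm \<Rightarrow> real ^ 'm \<Rightarrow> real ^ 'm"
    and \<psi> :: "'c \<Rightarrow> real ^ 'm \<Rightarrow> real ^ 's"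
  assumes rep: "spin_module \<rho>"
    and struct: "spin_structure U e s"
    and killing: "generalized_killing_with \<rho> U e s A \<psi>"
    and dims: "CARD('n) mod 4 = 0" "CARD('s) = 2 * CARD('n)"
begin

abbreviation "c \<equiv> clifford_action \<rho>"
abbreviation "\<omega> \<equiv> \<lambda>\<phi>. \<rho> (axis UNIV 1) *v \<phi>"

sublocale graded_clifford_module_coords c \<omega>
  by (simp add: graded_clifford_module_coords_def spin_module_graded rep dims)

lemma card_n_ge: "CARD('n) \<ge> 3"
proof -
  have "4 dvd CARD('n)" using dims(1) by presburger
  then have "4 \<le> CARD('n)" by (rule dvd_imp_le) simp
  then show ?thesis by simp
qed

lemma structD:
  "CARD('m) = CARD('n) + 1" "(\<Union>a. U a) = unit_sphere"
  "openin (top_of_set unit_sphere) (U a)" "smooth_on_sphere (U a) (e a i)"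
  "p \<in> U a \<Longrightarrow> e a i p \<bullet> p = 0"
  "p \<in> U a \<Longrightarrow> e a i p \<bullet> e a j p = (if i = j then 1 else 0)"
  "p \<in> U a \<inter> U b \<Longrightarrow> s a b p \<in> Spin"
  using struct unfolding spin_structure_def by auto

lemma U_sphere: "p \<in> U a \<Longrightarrow> norm p = 1"
  using structD(2) by (metis UN_I UNIV_I mem_sphere_0)

lemma killingD:
  "smooth_on_sphere (U a) (\<psi> a)"
  "p \<in> U a \<inter> U b \<Longrightarrow> \<psi> a p = \<rho> (s a b p) *v \<psi> b p"
  "\<exists>a. \<exists>p\<in>U a. \<psi> a p \<noteq> 0"
  "p \<in> U a \<Longrightarrow> X \<in> tangent_space p \<Longrightarrow>
    spinor_connection \<rho> (e a) (\<psi> a) p X = clifford_mult \<rho> (e a) p (A p X) (\<psi> a p)"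
  using killing unfolding generalized_killing_with_def spinor_field_def by blast+

lemma endoD:
  assumes "p \<in> unit_sphere"
  shows "linear (A p)" "X \<in> tangent_space p \<Longrightarrow> A p X \<in> tangent_space p"
    "X \<in> tangent_space p \<Longrightarrow> Y \<in> tangent_space p \<Longrightarrow> A p X \<bullet> Y = X \<bullet> A p Y"
  using killing assms unfolding generalized_killing_with_def symmetric_endo_field_def by auto

lemma endo_smooth: "smooth_on_sphere unit_sphere (\<lambda>p. A p (v - (v \<bullet> p) *\<^sub>R p))"
  using killing unfolding generalized_killing_with_def symmetric_endo_field_def by auto

abbreviation W :: "'c \<Rightarrow> (real ^ 'm) set" where "W a \<equiv> cone_over (U a)"
abbreviation "frame a \<equiv> \<lambda>i. radial_ext (e a i)"
abbreviation "spinor a \<equiv> radial_ext (\<psi> a)"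
abbreviation "endo v \<equiv> radial_ext (\<lambda>p. A p (v - (v \<bullet> p) *\<^sub>R p))"

text \<open>
  The coordinates of A applied to the tangential part of v.  The endomorphism field is smooth only
  after the tangential projection, which is why it enters through endo.
\<close>

definition \<alpha> :: "'c \<Rightarrow> real ^ 'm \<Rightarrow> real ^ 'm \<Rightarrow> (real, 'n) vec" where
  "\<alpha> a y v = (\<chi> k. inverse (norm y) * (endo v y \<bullet> frame a k y))"

lemma W: "open (W a)" "x \<in> W a \<Longrightarrow> x \<noteq> 0" "x \<in> W a \<Longrightarrow> sgn x \<in> U a" "x \<in> W a \<Longrightarrow> sgn x \<in> W a"
  using open_cone_over[OF structD(3)] by (simp_all add: cone_over_sgn sgn_sgn_vector sgn_zero_iff)

lemma W_cover: "x \<noteq> 0 \<Longrightarrow> \<exists>a. x \<in> W a"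
  using structD(2) sgn_in_sphere[of x] by (auto simp: cone_over_sgn simp del: mem_sphere)

lemma Ck_on_frame: "Ck_on k (W a) (frame a i)" and Ck_on_spinor: "Ck_on k (W a) (spinor a)"
  using structD(4)[of a i] killingD(1)[of a] by (simp_all add: smooth_on_sphere_iff)

lemma Ck_on_endo: "Ck_on k (- {0}) (endo v)"
  using endo_smooth[of v] by (simp add: smooth_on_sphere_iff cone_over_unit_sphere)

lemma frame_orthonormal:
  assumes "x \<in> W a"
  shows "frame a i x \<bullet> frame a j x = (if i = j then 1 else 0)" "frame a i x \<bullet> sgn x = 0" "sgn x \<bullet> sgn x = 1"
  using structD(5,6)[OF W(3)[OF assms]] W(2)[OF assms] by (simp_all add: radial_ext_sgn dot_square_norm norm_sgn)

lemma endo_coords: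
  assumes "x \<in> W a"
  shows "\<alpha> a x v = frame_coords (e a) (sgn x) (A (sgn x) (sgn_deriv x v))"
  using endoD(1)[OF sgn_in_sphere[OF W(2)[OF assms]]]
  by (simp add: vec_eq_iff \<alpha>_def frame_coords_def radial_ext_sgn sgn_deriv_def linear_cmul)

text \<open>
  On the cone over the domain of a frame the generalized Killing equation becomes an equation between
  functions on an open set of the ambient space, valid in all directions including the radial one.
\<close>

lemma spinor_equation_in_frame:
  assumes x: "x \<in> W a"
  shows "frechet_derivative (spinor a) (at x) v
    = c (\<alpha> a x v) (spinor a x) - bivector (frame_connection (frame a) x v) (spinor a x)"
proof -
  let ?p = "sgn x" and ?X = "sgn_deriv x v"
  have p: "?p \<in> U a" "?p \<in> W a" "x \<noteq> 0" using W x by auto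
  have d: "frame a i differentiable (at ?p)" "spinor a differentiable (at ?p)" for i
    using Ck_on_2_has_derivative(1)[OF W(1) p(2) Ck_on_frame] Ck_on_2_has_derivative(1)[OF W(1) p(2) Ck_on_spinor]
    by (auto intro: differentiableI)
  have "frame_coords (e a) ?p (e a i ?p) = axis i 1" for i
    using structD(6)[OF p(1)] by (simp add: frame_coords_def vec_eq_iff axis_def)
  moreover have "levi_civita (e a i) ?p ?X \<bullet> e a j ?p = frame_connection (frame a) x v $ i $ j" for i j
    using structD(5)[OF p(1), of j]
    by (simp add: levi_civita_def inner_diff_left inner_commute[of ?p] frame_connection_def
        frechet_derivative_radial_ext[OF p(3) d(1)] radial_ext_sgn[of _ x])
  ultimately have "spinor_connection \<rho> (e a) (\<psi> a) ?p ?X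
      = frechet_derivative (spinor a) (at x) v + bivector (frame_connection (frame a) x v) (spinor a x)"
    unfolding spinor_connection_def clifford_mult_def bivector_def
    by (simp add: clifford_action_def frechet_derivative_radial_ext[OF p(3) d(2)] radial_ext_sgn[of _ x])
  moreover have "clifford_mult \<rho> (e a) ?p (A ?p ?X) (\<psi> a ?p) = c (\<alpha> a x v) (spinor a x)"
    by (simp add: clifford_mult_def clifford_action_def endo_coords[OF x] radial_ext_sgn)
  ultimately show ?thesis
    using killingD(4)[OF p(1) sgn_deriv_tangent[OF p(3)], of v] by (simp add: algebra_simps)
qed

lemma endo_coords_differentiable:
  assumes "x \<in> W a"
  shows "(\<lambda>y. \<alpha> a y v) differentiable (at x)"
proof -
  have x: "x \<noteq> 0" using W assms by auto
  have "endo v differentiable (at x)"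
    using Ck_on_2_has_derivative(1)[OF _ _ Ck_on_endo] x by (auto simp: differentiable_def)
  moreover have "frame a k differentiable (at x)" for k
    using Ck_on_2_has_derivative(1)[OF W(1) assms Ck_on_frame] by (auto simp: differentiable_def)
  moreover have "(\<lambda>y :: real ^ 'm. inverse (norm y)) differentiable (at x)"
    using x by (intro differentiable_inverse) auto
  ultimately have "(\<lambda>y. inverse (norm y) * (endo v y \<bullet> frame a k y)) differentiable (at x)" for k
    by (intro differentiable_mult differentiable_inner)
  then have "\<forall>k. \<exists>f'. ((\<lambda>y. inverse (norm y) * (endo v y \<bullet> frame a k y)) has_derivative f') (at x)"
    by (simp add: differentiable_def)
  from choice[OF this] obtain f' where
    "((\<lambda>y. inverse (norm y) * (endo v y \<bullet> frame a k y)) has_derivative f' k) (at x)" for k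
    by blast
  from has_derivative_vec_lambda[OF this] show ?thesis
    unfolding \<alpha>_def by (rule differentiableI)
qed

lemma local_frame:
  assumes x: "x \<in> W a"
  shows "moving_frame_spinor (W a) (frame a) sgn (sgn_deriv x) x c \<omega> (spinor a) (\<alpha> a)"
proof -
  interpret mf: moving_frame "W a" "frame a" sgn "sgn_deriv x" x
    using x structD(1) W(1) Ck_on_frame frame_orthonormal has_derivative_sgn[OF W(2)[OF x]]
    by unfold_locales auto
  show ?thesis
    using x Ck_on_spinor endo_coords_differentiable spinor_equation_in_frame
    by unfold_locales
qed

text \<open>
  The inverse of the frame coordinates on the tangent space.
\<close>

definition lift :: "'c \<Rightarrow> real ^ 'm \<Rightarrow> (real, 'n) vec \<Rightarrow> real ^ 'm" where
  "lift a p w = (\<Sum>k\<in>UNIV. (w $ k) *\<^sub>R e a k p)"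

lemma lift_frame_coords:
  assumes p: "p \<in> U a"
  shows "linear (lift a p)" "lift a p w \<in> tangent_space p" "frame_coords (e a) p (lift a p w) = w"
    "X \<in> tangent_space p \<Longrightarrow> lift a p (frame_coords (e a) p X) = X"
    "X \<bullet> lift a p w = frame_coords (e a) p X \<bullet> w"
proof -
  show "linear (lift a p)"
    by (rule linearI) (simp_all add: lift_def scaleR_left_distrib sum.distrib scaleR_sum_right)
  show tan: "lift a p w \<in> tangent_space p" for w
    using structD(5)[OF p] by (simp add: lift_def inner_sum_left)
  show fc: "frame_coords (e a) p (lift a p w) = w" for w
    by (simp add: lift_def frame_coords_def inner_sum_left vec_eq_iff structD(6)[OF p] if_distrib cong: if_cong)
  show in_lift: "X \<bullet> lift a p w = frame_coords (e a) p X \<bullet> w" for X w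
  proof -
    have "frame_coords (e a) p X \<bullet> w = (\<Sum>k\<in>UNIV. (X \<bullet> e a k p) * w $ k)"
      by (simp add: frame_coords_def inner_vec_def)
    then show ?thesis by (simp add: lift_def inner_sum_right mult.commute)
  qed
  assume X: "X \<in> tangent_space p"
  have np: "p \<bullet> p = 1" using U_sphere[OF p] by (simp add: dot_square_norm)
  let ?Y = "X - lift a p (frame_coords (e a) p X)"
  have "?Y \<bullet> e a i p = 0" for i
  proof -
    have "frame_coords (e a) p ?Y = 0"
      using fc[of "frame_coords (e a) p X"] by (simp add: frame_coords_def vec_eq_iff inner_diff_left)
    then show ?thesis by (simp add: frame_coords_def vec_eq_iff)
  qed
  moreover have "?Y \<bullet> p = 0" using X tan by (simp add: inner_diff_left)
  ultimately have "?Y \<bullet> ?Y = 0"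
    using orthonormal_frame_inner[of "\<lambda>i. e a i p" p ?Y ?Y] structD(1,5,6) p np by simp
  then show "lift a p (frame_coords (e a) p X) = X" by simp
qed

definition endo_matrix :: "'c \<Rightarrow> real ^ 'm \<Rightarrow> (real, 'n) vec \<Rightarrow> (real, 'n) vec" where
  "endo_matrix a p w = frame_coords (e a) p (A p (lift a p w))"

lemma endo_matrix_symmetric:
  assumes p: "p \<in> U a"
  shows "linear (endo_matrix a p)" "endo_matrix a p v \<bullet> w = v \<bullet> endo_matrix a p w"
proof -
  have S: "p \<in> unit_sphere" using U_sphere[OF p] by simp
  show "linear (endo_matrix a p)"
    using endoD(1)[OF S] lift_frame_coords(1)[OF p] unfolding endo_matrix_def
    by (intro linearI) (simp_all add: frame_coords_def vec_eq_iff linear_add linear_cmul inner_add_left)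
  show "endo_matrix a p v \<bullet> w = v \<bullet> endo_matrix a p w"
    using endoD(3)[OF S lift_frame_coords(2)[OF p] lift_frame_coords(2)[OF p], of v w] lift_frame_coords(5)[OF p]
    by (metis endo_matrix_def inner_commute)
qed

lemma curvature_in_frame:
  assumes x: "x \<in> W a"
  shows "\<exists>b. spinor_curvature (endo_matrix a (sgn x)) u v (spinor a x) = c b (spinor a x)"
proof -
  interpret mf: moving_frame_spinor "W a" "frame a" sgn "sgn_deriv x" x c \<omega> "spinor a" "\<alpha> a"
    by (rule local_frame[OF x])
  let ?p = "sgn x"
  have p: "?p \<in> U a" "x \<noteq> 0" using W x by auto
  have d: "sgn_deriv x (norm x *\<^sub>R lift a ?p w) = lift a ?p w" for w
    using sgn_deriv_of_tangent p lift_frame_coords(2) by metis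
  have 1: "\<alpha> a x (norm x *\<^sub>R lift a ?p w) = endo_matrix a ?p w" for w
    by (simp add: endo_coords[OF x] d endo_matrix_def)
  have 2: "(\<chi> k. sgn_deriv x (norm x *\<^sub>R lift a ?p w) \<bullet> frame a k x) = w" for w
    using lift_frame_coords(3)[OF p(1), of w] by (simp add: d frame_coords_def radial_ext_sgn)
  show ?thesis
    using mf.curvature_identity[of "norm x *\<^sub>R lift a ?p v" "norm x *\<^sub>R lift a ?p u"]
    unfolding 1 2 spinor_curvature_def .
qed

text \<open>
  The cocycle acts by orthogonal matrices, so |\<psi>|^2 is a function on the punctured space that does
  not depend on the frame.  Its derivative vanishes, because vectors and bivectors act by skew
  endomorphisms.
\<close>

lemma spinor_nonzero:
  assumes "x \<in> W a"
  shows "spinor a x \<noteq> 0"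
proof -
  define g where "g x = (let b = SOME b. x \<in> W b in spinor b x \<bullet> spinor b x)" for x
  have g: "g y = spinor b y \<bullet> spinor b y" if "y \<in> W b" for y b
  proof -
    define d where "d = (SOME b. y \<in> W b)"
    have "y \<in> W d" unfolding d_def by (rule someI[of _ b]) (rule that)
    then have p: "sgn y \<in> U d \<inter> U b" using W that by auto
    have "orthogonal_matrix (\<rho> (s d b (sgn y)))"
      using spin_module_Spin_orthogonal[OF rep] structD(7)[OF p] by auto
    then have "orthogonal_transformation (\<lambda>\<phi>. \<rho> (s d b (sgn y)) *v \<phi>)"
      by (simp add: orthogonal_transformation_matrix)
    then have "spinor d y \<bullet> spinor d y = spinor b y \<bullet> spinor b y"
      using killingD(2)[OF p] by (simp add: radial_ext_sgn orthogonal_transformation_def)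
    then show ?thesis by (simp add: g_def d_def)
  qed
  have "(g has_derivative (\<lambda>h. 0)) (at y)" if "y \<in> - {0}" for y
  proof -
    have "y \<noteq> 0" using that by simp
    then obtain b where b: "y \<in> W b" using W_cover by blast
    interpret mf: moving_frame_spinor "W b" "frame b" sgn "sgn_deriv y" y c \<omega> "spinor b" "\<alpha> b"
      by (rule local_frame[OF b])
    show ?thesis
      by (rule has_derivative_transform_within_open[OF mf.norm_derivative_zero W(1) b]) (simp add: g)
  qed
  moreover have "connected (- {0 :: real ^ 'm})"
    by (rule connected_punctured_universe) (use structD(1) card_n_ge in auto)
  moreover obtain b p where bp: "p \<in> U b" "\<psi> b p \<noteq> 0" using killingD(3) by blast
  moreover have "p \<in> W b" "spinor b p = \<psi> b p" "p \<noteq> 0"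
  proof -
    have "norm p = 1" using bp U_sphere by blast
    then show "p \<in> W b" "spinor b p = \<psi> b p" "p \<noteq> 0"
      using bp by (auto simp: cone_over_def radial_ext_def)
  qed
  moreover have "x \<noteq> 0" using W assms by auto
  ultimately have "g x = g p"
    by (intro has_derivative_zero_unique_connected[of "- {0}" g x p]) auto
  then show ?thesis using g[OF assms] g[OF \<open>p \<in> W b\<close>] bp \<open>spinor b p = \<psi> b p\<close> by auto
qed

text \<open>
  The points x such that A is mu times the identity on the tangent space at x / |x|.
\<close>

definition scalar_set :: "real \<Rightarrow> (real ^ 'm) set" where
  "scalar_set \<mu> = {x \<in> - {0}. \<forall>v. endo v x = \<mu> *\<^sub>R (v - (v \<bullet> sgn x) *\<^sub>R sgn x)}"

lemma scalar_set_closed: "closedin (top_of_set (- {0})) (scalar_set \<mu>)"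
proof -
  have "continuous_on (- {0}) (endo v)" for v using Ck_on_endo[of 0 v] by simp
  then have "continuous_on (- {0}) (\<lambda>x. endo v x - \<mu> *\<^sub>R (v - (v \<bullet> sgn x) *\<^sub>R sgn x))" for v
    by (intro continuous_intros) auto
  then have "closedin (top_of_set (- {0})) {x \<in> - {0}. endo v x - \<mu> *\<^sub>R (v - (v \<bullet> sgn x) *\<^sub>R sgn x) = 0}" for v
    by (rule continuous_closedin_preimage_constant)
  then have "closedin (top_of_set (- {0})) (\<Inter>v. {x \<in> - {0}. endo v x - \<mu> *\<^sub>R (v - (v \<bullet> sgn x) *\<^sub>R sgn x) = 0})"
    by (intro closedin_INT) auto
  moreover have "(\<Inter>v. {x \<in> - {0}. endo v x - \<mu> *\<^sub>R (v - (v \<bullet> sgn x) *\<^sub>R sgn x) = 0}) = scalar_set \<mu>"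
    by (auto simp: scalar_set_def)
  ultimately show ?thesis by simp
qed

lemma endo_scalar_if_vol_nonzero:
  assumes x: "x \<in> W a" and ne: "spinor a x \<bullet> \<omega> (spinor a x) \<noteq> 0"
  shows "x \<in> scalar_set (1/2) \<union> scalar_set (-1/2)"
proof -
  let ?p = "sgn x"
  have p: "?p \<in> U a" "x \<noteq> 0" "?p \<in> unit_sphere" "?p \<bullet> ?p = 1"
    using W(2,3)[OF x] sgn_in_sphere[of x] frame_orthonormal(3)[OF x] by auto
  have "DIM((real, 'n) vec) \<ge> 3" using card_n_ge by simp
  then obtain \<mu> where \<mu>: "\<mu> \<in> {1/2, -1/2}" "\<And>w. endo_matrix a ?p w = \<mu> *\<^sub>R w"
    using endomorphism_eq_half[OF _ endo_matrix_symmetric[OF p(1)] curvature_in_frame[OF x] ne]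
    by blast
  have "A ?p X = \<mu> *\<^sub>R X" if X: "X \<in> tangent_space ?p" for X
  proof -
    have "A ?p X = lift a ?p (frame_coords (e a) ?p (A ?p X))"
      using lift_frame_coords(4)[OF p(1)] endoD(2)[OF p(3) X] by simp
    also have "frame_coords (e a) ?p (A ?p X) = endo_matrix a ?p (frame_coords (e a) ?p X)"
      using lift_frame_coords(4)[OF p(1) X] by (simp add: endo_matrix_def)
    finally show ?thesis using lift_frame_coords(4)[OF p(1) X] by (simp add: \<mu>(2) linear_cmul[OF lift_frame_coords(1)[OF p(1)]])
  qed
  then have "x \<in> scalar_set \<mu>"
    using p by (auto simp: scalar_set_def radial_ext_sgn inner_diff_left)
  then show ?thesis using \<mu>(1) by blast
qed

text \<open>
  Outside the two closed sets the function f = \<psi> \<bullet> \<omega> \<psi> vanishes by the previous lemma.  This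
  happens on an open set, so the derivative of f vanishes there too, which is impossible.
\<close>

lemma endo_pointwise_scalar: "- {0} \<subseteq> scalar_set (1/2) \<union> scalar_set (-1/2)"
proof (rule ccontr)
  let ?C = "scalar_set (1/2) \<union> scalar_set (-1/2)"
  assume "\<not> - {0} \<subseteq> ?C"
  then obtain x where x: "x \<noteq> 0" "x \<notin> ?C" by auto
  obtain a where a: "x \<in> W a" using W_cover[of x] x by blast
  interpret mf: moving_frame_spinor "W a" "frame a" sgn "sgn_deriv x" x c \<omega> "spinor a" "\<alpha> a"
    by (rule local_frame[OF a])
  have "openin (top_of_set (- {0})) (- {0} - ?C)"
    using scalar_set_closed by (intro openin_diff closedin_Un) auto
  then have "open (- {0} - ?C)" by (rule openin_open_trans) auto
  then have O: "open (W a \<inter> (- {0} - ?C))" "x \<in> W a \<inter> (- {0} - ?C)"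
    using W(1) a x by auto
  have zero: "spinor a y \<bullet> \<omega> (spinor a y) = 0" if "y \<in> W a \<inter> (- {0} - ?C)" for y
    using that endo_scalar_if_vol_nonzero by auto
  have perp: "2 * (c (\<alpha> a x h) (spinor a x) \<bullet> \<omega> (spinor a x)) = 0" for h
    by (rule has_derivative_constant_zero[OF O zero mf.vol_derivative])
  let ?p = "sgn x"
  have p: "?p \<in> U a" "x \<noteq> 0" using W a by auto
  obtain w where "c (endo_matrix a ?p w) (spinor a x) \<bullet> \<omega> (spinor a x) \<noteq> 0"
    using vol_derivative_nonzero[OF _ _ endo_matrix_symmetric(2)[OF p(1)] curvature_in_frame[OF a]
        spinor_nonzero[OF a] zero[OF O(2)]] dims card_n_ge by auto
  moreover have "\<alpha> a x (norm x *\<^sub>R lift a ?p w) = endo_matrix a ?p w"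
    using sgn_deriv_of_tangent[OF p(2) lift_frame_coords(2)[OF p(1)], of w] by (simp add: endo_coords[OF a] endo_matrix_def)
  ultimately show False using perp[of "norm x *\<^sub>R lift a ?p w"] by simp
qed

text \<open>
  The two closed sets are disjoint and cover the connected punctured space.
\<close>

lemma endo_globally_scalar: "\<exists>\<mu>. \<mu> \<noteq> 0 \<and> scalar_set \<mu> = - {0}"
proof -
  have "scalar_set (1/2) \<inter> scalar_set (-1/2) = {}"
  proof (rule ccontr)
    assume "\<not> ?thesis"
    then obtain x where x: "x \<in> scalar_set (1/2)" "x \<in> scalar_set (-1/2)" by auto
    then have "x \<noteq> 0" by (simp add: scalar_set_def)
    then obtain a where a: "x \<in> W a" using W_cover by blast
    let ?v = "frame a undefined x"
    have v: "?v - (?v \<bullet> sgn x) *\<^sub>R sgn x = ?v" using frame_orthonormal(2)[OF a] by simp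
    have "endo ?v x = (1/2) *\<^sub>R (?v - (?v \<bullet> sgn x) *\<^sub>R sgn x)"
      using x(1) unfolding scalar_set_def by blast
    moreover have "endo ?v x = (-1/2) *\<^sub>R (?v - (?v \<bullet> sgn x) *\<^sub>R sgn x)"
      using x(2) unfolding scalar_set_def by blast
    ultimately have "(1/2) *\<^sub>R ?v = (-1/2) *\<^sub>R ?v" unfolding v by metis
    then have "?v = 0" by (simp add: eq_neg_iff_add_eq_0 flip: scaleR_left_distrib)
    then show False using frame_orthonormal(1)[OF a, of undefined undefined] by simp
  qed
  moreover have "connected (- {0 :: real ^ 'm})"
    by (rule connected_punctured_universe) (use structD(1) card_n_ge in auto)
  ultimately have "scalar_set (1/2) = {} \<or> scalar_set (-1/2) = {}"
    using endo_pointwise_scalar scalar_set_closed unfolding connected_closedin by meson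
  moreover have "scalar_set \<mu> \<subseteq> - {0}" for \<mu> by (auto simp: scalar_set_def)
  ultimately have "scalar_set (1/2) = - {0} \<or> scalar_set (-1/2) = - {0}"
    using endo_pointwise_scalar by fastforce
  then show ?thesis by (metis divide_eq_0_iff neg_equal_0_iff_equal zero_neq_numeral zero_neq_one)
qed

theorem spinor_is_killing: "killing_spinor \<rho> U e s \<psi>"
proof -
  obtain \<mu> where \<mu>: "\<mu> \<noteq> 0" "scalar_set \<mu> = - {0}" using endo_globally_scalar by blast
  have endo: "endo v x = \<mu> *\<^sub>R (v - (v \<bullet> sgn x) *\<^sub>R sgn x)" if "x \<noteq> 0" for v x
    using that \<mu>(2) unfolding scalar_set_def by blast
  have A: "A p X = \<mu> *\<^sub>R X" if "p \<in> unit_sphere" "X \<in> tangent_space p" for p X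
  proof -
    have "sgn p = p" "p \<noteq> 0" using that(1) by (auto simp: sgn_div_norm)
    then show ?thesis using endo[of p X] that(2) by (simp add: radial_ext_sgn)
  qed
  \<comment> \<open>Away from the origin this is the given smooth field, although the two may differ at the origin.\<close>
  have "Ck_on k (- {0}) (radial_ext (\<lambda>p. \<mu> *\<^sub>R (v - (v \<bullet> p) *\<^sub>R p)))" for k and v :: "real ^ 'm"
    by (rule Ck_on_cong[OF _ _ Ck_on_endo[of k v]]) (auto simp: endo, simp add: radial_ext_sgn)
  then have "smooth_on_sphere unit_sphere (\<lambda>p. \<mu> *\<^sub>R (v - (v \<bullet> p) *\<^sub>R p))" for v :: "real ^ 'm"
    by (simp add: smooth_on_sphere_iff cone_over_unit_sphere)
  then have "symmetric_endo_field (\<lambda>p X. \<mu> *\<^sub>R X :: real ^ 'm)"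
    by (auto simp: symmetric_endo_field_def linear_iff algebra_simps)
  moreover have "spinor_connection \<rho> (e a) (\<psi> a) p X = clifford_mult \<rho> (e a) p (\<mu> *\<^sub>R X) (\<psi> a p)"
    if "p \<in> U a" "X \<in> tangent_space p" for a p X
    using killingD(4)[OF that] A[of p X] that U_sphere[OF that(1)] by simp
  ultimately have "generalized_killing_with \<rho> U e s (\<lambda>p X. \<mu> *\<^sub>R X) \<psi>"
    using killing unfolding generalized_killing_with_def by blast
  then show ?thesis unfolding killing_spinor_def using \<mu>(1) by blast
qed

end

theorem corollary3p2:
  fixes \<rho> :: "8 clifford \<Rightarrow> real ^ 16 ^ 16"
    and U :: "'c \<Rightarrow> (real ^ 9) set"
    and e :: "'c \<Rightarrow> 8 \<Rightarrow> real ^ 9 \<Rightarrow> real ^ 9"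
    and s :: "'c \<Rightarrow> 'c \<Rightarrow> real ^ 9 \<Rightarrow> 8 clifford"
    and \<psi> :: "'c \<Rightarrow> real ^ 9 \<Rightarrow> real ^ 16"
  assumes "spin_module \<rho>"
    and "spin_structure U e s"
    and "generalized_killing_spinor \<rho> U e s \<psi>"
  shows "killing_spinor \<rho> U e s \<psi>"
proof -
  obtain A where "generalized_killing_with \<rho> U e s A \<psi>"
    using assms(3) unfolding generalized_killing_spinor_def by blast
  then interpret generalized_killing \<rho> U e s A \<psi>
    using assms(1,2) by unfold_locales auto
  show ?thesis by (rule spinor_is_killing)
qed

end
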